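(* Let $k$ be a finite field of characteristic $p$ with $q$ elements, and let $G$ be the infinite dimensional unitary Grassmann algebra over $k$. If $p=2$, then $$T(G)=\{\,x_1^{2}-x_1^{2q},\ [x_1,x_2]\,\}^T,$$ and otherwise (i.e. if $p>2$) $$T(G)=\{\,x_1^{qp}-x_1^{p},\ [x_1,x_2,x_3]\,\}^T .$$
   Context: $X=\{x_i\mid i\ge 1\}$ is a countably infinite set and $k_1\langle X\rangle$ is the free unitary associative $k$-algebra over $X$. Commutators: $[a,b]=ab-ba$ and $[a,b,c]=[[a,b],c]$. A $T$-ideal of $k_1\langle X\rangle$ is a (two-sided) ideal that is invariant under all (unitary) algebra endomorphisms of $k_1\langle X\rangle$. For a subset $B\subseteq k_1\langle X\rangle$, $B^T$ denotes the smallest $T$-ideal of $k_1\langle X\rangle$ containing $B$. $G$ is the unitary associative $k$-algebra generated by elements $e_i$, $i\ge1$, with $e_ie_j=-e_je_i$ and $e_i^2=0$ for all $i,j$, having as linear basis $1$ together with $\mathcal{B}=\{e_{i_1}e_{i_2}\cdots e_{i_n}\mid n\ge1,\ i_1<i_2<\cdots<i_n\}$. $T(G)\subseteq k_1\langle X\rangle$ is the $T$-ideal of identities of $G$: the set of all $f\in k_1\langle X\rangle$ that lie in the kernel of every unitary $k$-algebra homomorphism $k_1\langle X\rangle\to G$. *)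

theory Defs
  imports Complex_Main "HOL-Library.Poly_Mapping" "HOL-Library.Cardinality"
    "HOL-Computational_Algebra.Primes"
begin

section \<open>The free unitary associative algebra\<close>

datatype 'a free_monoid = Word (letters: "'a list")

instantiation free_monoid :: (type) monoid_add
begin

definition "0 = Word []"

definition "v + w = Word (letters v @ letters w)"

instance
  by standard (simp_all add: zero_free_monoid_def plus_free_monoid_def)

end

text \<open>
  The monoid algebra over \<open>'k\<close> of the free monoid on the countably infinite alphabet \<open>nat\<close>;
  its multiplication is the convolution product of \<^theory>\<open>HOL-Library.Poly_Mapping\<close>.
\<close>

type_synonym 'k free_alg = "nat free_monoid \<Rightarrow>\<^sub>0 'k"

text \<open>Indices start at \<open>0\<close>: the variable \<open>x\<^sub>i\<close> with \<open>i \<ge> 1\<close> is \<open>var (i - 1)\<close>.\<close>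

definition var :: "nat \<Rightarrow> 'k::field free_alg" where
  "var i = Poly_Mapping.single (Word [i]) 1"

lift_definition fscale :: "'k::field \<Rightarrow> 'k free_alg \<Rightarrow> 'k free_alg"
  is "\<lambda>c f w. c * f w"
  by (erule rev_finite_subset) auto

lemma lookup_fscale [simp]:
  "Poly_Mapping.lookup (fscale c f) w = c * Poly_Mapping.lookup f w"
  by (simp add: fscale.rep_eq)

lemma fscale_eq_mult: "fscale c f = Poly_Mapping.single 0 c * f"
proof -
  have "fscale c f = (\<Sum>w\<in>Poly_Mapping.keys f.
      Poly_Mapping.single w (c * Poly_Mapping.lookup f w))"
    by (rule poly_mapping_eqI)
       (simp add: lookup_sum lookup_single when_def not_in_keys_iff_lookup_eq_zero)
  also have "\<dots> = Poly_Mapping.single 0 c *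
      (\<Sum>w\<in>Poly_Mapping.keys f. Poly_Mapping.single w (Poly_Mapping.lookup f w))"
    by (simp add: sum_distrib_left mult_single)
  also have "(\<Sum>w\<in>Poly_Mapping.keys f. Poly_Mapping.single w (Poly_Mapping.lookup f w)) = f"
    by (rule poly_mapping_eqI)
       (simp add: lookup_sum lookup_single when_def not_in_keys_iff_lookup_eq_zero)
  finally show ?thesis .
qed

lemma vector_space_fscale: "vector_space fscale"
  by unfold_locales
     (auto intro!: poly_mapping_eqI simp: lookup_add algebra_simps)

definition comm :: "'a::ring \<Rightarrow> 'a \<Rightarrow> 'a" where
  "comm a b = a * b - b * a"

section \<open>Unitary algebra homomorphisms and T-ideals\<close>

definition unital_alg_hom ::
  "('k::field \<Rightarrow> 'a::ring_1 \<Rightarrow> 'a) \<Rightarrow> ('k \<Rightarrow> 'b::ring_1 \<Rightarrow> 'b) \<Rightarrow> ('a \<Rightarrow> 'b) \<Rightarrow> bool" where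
  "unital_alg_hom s1 s2 \<phi> \<longleftrightarrow>
     Vector_Spaces.linear s1 s2 \<phi> \<and> \<phi> 1 = 1 \<and> (\<forall>a b. \<phi> (a * b) = \<phi> a * \<phi> b)"

text \<open>
  Closure under negation and scalars is implied by absorption, as the algebra is unitary.
\<close>

definition T_ideal :: "'k::field free_alg set \<Rightarrow> bool" where
  "T_ideal I \<longleftrightarrow>
     0 \<in> I \<and> (\<forall>f\<in>I. \<forall>g\<in>I. f + g \<in> I) \<and>
     (\<forall>f\<in>I. \<forall>g. g * f \<in> I \<and> f * g \<in> I) \<and>
     (\<forall>\<phi>. unital_alg_hom fscale fscale \<phi> \<longrightarrow> \<phi> ` I \<subseteq> I)"

definition T_closure :: "'k::field free_alg set \<Rightarrow> 'k free_alg set" where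
  "T_closure B = \<Inter>{I. T_ideal I \<and> B \<subseteq> I}"

lemma T_ideal_T_closure: "T_ideal (T_closure B)"
  unfolding T_closure_def T_ideal_def by blast

section \<open>The infinite dimensional unitary Grassmann algebra\<close>

text \<open>
  An element is given by its coordinates in the linear basis consisting of the monomials
  \<open>e\<^sub>A = e\<^bsub>i1\<^esub> \<cdots> e\<^bsub>in\<^esub>\<close>, one for each finite set \<open>A = {i1 < \<dots> < in}\<close>, where \<open>e\<^sub>A = 1\<close> for
  empty \<open>A\<close>.  As for the variables, indices start at \<open>0\<close>.
\<close>

typedef (overloaded) 'k grassmann =
  "{f :: nat set \<Rightarrow> 'k::zero. finite {A. f A \<noteq> 0} \<and> (\<forall>A. infinite A \<longrightarrow> f A = 0)}"
  morphisms coord Abs_grassmann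
  by (rule exI [of _ "\<lambda>_. 0"]) simp

setup_lifting type_definition_grassmann

text \<open>
  The sign relating two monomials with disjoint index sets to their product:
  \<open>e\<^sub>A * e\<^sub>B = gsign A B \<cdot> e\<^bsub>A \<union> B\<^esub>\<close>, where the exponent counts the inversions.
\<close>

definition gsign :: "nat set \<Rightarrow> nat set \<Rightarrow> 'k::ring_1" where
  "gsign A B = (- 1) ^ card {(a, b). a \<in> A \<and> b \<in> B \<and> b < a}"

lemma gsign_empty [simp]: "gsign {} B = 1" "gsign A {} = 1"
  by (simp_all add: gsign_def)

lemma finite_inversions:
  assumes "finite A" "finite B"
  shows "finite {(a, b). a \<in> A \<and> b \<in> B \<and> b < (a::nat)}"
  by (rule finite_subset [of _ "A \<times> B"]) (use assms in auto)

lemma gsign_Un_left: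
  assumes "finite A" "finite B" "finite C" "A \<inter> B = {}"
  shows "gsign (A \<union> B) C = (gsign A C * gsign B C :: 'k::ring_1)"
proof -
  have "{(a, b). a \<in> A \<union> B \<and> b \<in> C \<and> b < a} =
      {(a, b). a \<in> A \<and> b \<in> C \<and> b < a} \<union> {(a, b). a \<in> B \<and> b \<in> C \<and> b < a}"
    by auto
  moreover have "card \<dots> = card {(a, b). a \<in> A \<and> b \<in> C \<and> b < a}
      + card {(a, b). a \<in> B \<and> b \<in> C \<and> b < a}"
    by (rule card_Un_disjoint) (use assms in \<open>auto intro: finite_inversions\<close>)
  ultimately show ?thesis
    by (simp add: gsign_def power_add)
qed

lemma gsign_Un_right:
  assumes "finite A" "finite B" "finite C" "B \<inter> C = {}"
  shows "gsign A (B \<union> C) = (gsign A B * gsign A C :: 'k::ring_1)"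
proof -
  have "{(a, b). a \<in> A \<and> b \<in> B \<union> C \<and> b < a} =
      {(a, b). a \<in> A \<and> b \<in> B \<and> b < a} \<union> {(a, b). a \<in> A \<and> b \<in> C \<and> b < a}"
    by auto
  moreover have "card \<dots> = card {(a, b). a \<in> A \<and> b \<in> B \<and> b < a}
      + card {(a, b). a \<in> A \<and> b \<in> C \<and> b < a}"
    by (rule card_Un_disjoint) (use assms in \<open>auto intro: finite_inversions\<close>)
  ultimately show ?thesis
    by (simp add: gsign_def power_add)
qed

instantiation grassmann :: (field) ring_1
begin

lift_definition zero_grassmann :: "'a grassmann" is "\<lambda>_. 0"
  by simp

lift_definition one_grassmann :: "'a grassmann" is "\<lambda>A. if A = {} then 1 else 0"
  by auto

lift_definition plus_grassmann :: "'a grassmann \<Rightarrow> 'a grassmann \<Rightarrow> 'a grassmann"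
  is "\<lambda>f g A. f A + g A"
proof (intro conjI)
  fix f g :: "nat set \<Rightarrow> 'a"
  assume f: "finite {A. f A \<noteq> 0} \<and> (\<forall>A. infinite A \<longrightarrow> f A = 0)"
    and g: "finite {A. g A \<noteq> 0} \<and> (\<forall>A. infinite A \<longrightarrow> g A = 0)"
  show "finite {A. f A + g A \<noteq> 0}"
  proof (rule finite_subset)
    show "{A. f A + g A \<noteq> 0} \<subseteq> {A. f A \<noteq> 0} \<union> {A. g A \<noteq> 0}" by auto
    show "finite ({A. f A \<noteq> 0} \<union> {A. g A \<noteq> 0})" using f g by simp
  qed
  show "\<forall>A. infinite A \<longrightarrow> f A + g A = 0"
    using f g by simp
qed

lift_definition uminus_grassmann :: "'a grassmann \<Rightarrow> 'a grassmann" is "\<lambda>f A. - f A"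
  by simp

definition minus_grassmann :: "'a grassmann \<Rightarrow> 'a grassmann \<Rightarrow> 'a grassmann"
  where "minus_grassmann f g = f + - g"

text \<open>For infinite \<open>S\<close> the sum is \<open>0\<close> by the convention for sums over infinite sets.\<close>

lift_definition times_grassmann :: "'a grassmann \<Rightarrow> 'a grassmann \<Rightarrow> 'a grassmann"
  is "\<lambda>f g S. \<Sum>A\<in>Pow S. gsign A (S - A) * f A * g (S - A)"
proof (intro conjI allI impI)
  fix f g :: "nat set \<Rightarrow> 'a"
  assume f: "finite {A. f A \<noteq> 0} \<and> (\<forall>A. infinite A \<longrightarrow> f A = 0)"
    and g: "finite {A. g A \<noteq> 0} \<and> (\<forall>A. infinite A \<longrightarrow> g A = 0)"
  let ?U = "(\<lambda>(A, B). A \<union> B) ` ({A. f A \<noteq> 0} \<times> {A. g A \<noteq> 0})"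
  have "{S. (\<Sum>A\<in>Pow S. gsign A (S - A) * f A * g (S - A)) \<noteq> 0} \<subseteq> ?U"
  proof
    fix S assume "S \<in> {S. (\<Sum>A\<in>Pow S. gsign A (S - A) * f A * g (S - A)) \<noteq> 0}"
    then have "(\<Sum>A\<in>Pow S. gsign A (S - A) * f A * g (S - A)) \<noteq> 0"
      by simp
    then obtain A where A: "A \<in> Pow S" "gsign A (S - A) * f A * g (S - A) \<noteq> 0"
      by (rule sum.not_neutral_contains_not_neutral)
    then have "f A \<noteq> 0" "g (S - A) \<noteq> 0"
      by simp_all
    moreover have "S = A \<union> (S - A)"
      using A(1) by blast
    ultimately show "S \<in> ?U"
      by (intro image_eqI [of _ _ "(A, S - A)"]) simp_all
  qed
  then show "finite {S. (\<Sum>A\<in>Pow S. gsign A (S - A) * f A * g (S - A)) \<noteq> 0}"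
    by (rule finite_subset) (use f g in simp)
next
  fix f g :: "nat set \<Rightarrow> 'a" and S :: "nat set"
  assume "infinite S"
  then show "(\<Sum>A\<in>Pow S. gsign A (S - A) * f A * g (S - A)) = 0"
    by simp
qed

instance
proof
  fix a b c :: "'a grassmann"
  show "a + b + c = a + (b + c)" by transfer (simp add: add.assoc)
  show "a + b = b + a" by transfer (simp add: add.commute)
  show "0 + a = a" by transfer simp
  show "- a + a = 0" by transfer simp
  show "a - b = a + - b" by (fact minus_grassmann_def)
  show "(a + b) * c = a * c + b * c"
    by transfer (simp add: algebra_simps sum.distrib)
  show "a * (b + c) = a * b + a * c"
    by transfer (simp add: algebra_simps sum.distrib)
  show "(0::'a grassmann) \<noteq> 1" by transfer (auto simp: fun_eq_iff)
  show "1 * a = a"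
  proof (transfer, rule ext)
    fix f :: "nat set \<Rightarrow> 'a" and S
    assume f: "finite {A. f A \<noteq> 0} \<and> (\<forall>A. infinite A \<longrightarrow> f A = 0)"
    show "(\<Sum>A\<in>Pow S. gsign A (S - A) * (if A = {} then 1 else 0) * f (S - A)) = f S"
    proof (cases "finite S")
      case True
      then have "(\<Sum>A\<in>Pow S. gsign A (S - A) * (if A = {} then 1 else 0) * f (S - A)) =
        (\<Sum>A\<in>{{}}. gsign A (S - A) * (if A = {} then 1 else 0) * f (S - A))"
        by (intro sum.mono_neutral_right) auto
      then show ?thesis by simp
    qed (use f in simp)
  qed
  show "a * 1 = a"
  proof (transfer, rule ext)
    fix f :: "nat set \<Rightarrow> 'a" and S
    assume f: "finite {A. f A \<noteq> 0} \<and> (\<forall>A. infinite A \<longrightarrow> f A = 0)"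
    show "(\<Sum>A\<in>Pow S. gsign A (S - A) * f A * (if S - A = {} then 1 else 0)) = f S"
    proof (cases "finite S")
      case True
      then have "(\<Sum>A\<in>Pow S. gsign A (S - A) * f A * (if S - A = {} then 1 else 0)) =
        (\<Sum>A\<in>{S}. gsign A (S - A) * f A * (if S - A = {} then 1 else 0))"
        by (intro sum.mono_neutral_right) auto
      then show ?thesis by simp
    qed (use f in simp)
  qed
  show "a * b * c = a * (b * c)"
  proof (transfer, rule ext)
    fix f g h :: "nat set \<Rightarrow> 'a" and S :: "nat set"
    show "(\<Sum>A\<in>Pow S. gsign A (S - A) *
            (\<Sum>B\<in>Pow A. gsign B (A - B) * f B * g (A - B)) * h (S - A)) =
          (\<Sum>B\<in>Pow S. gsign B (S - B) * f B *
            (\<Sum>C\<in>Pow (S - B). gsign C (S - B - C) * g C * h (S - B - C)))"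
    proof (cases "finite S")
      case fin: True
      have fin': "finite A" if "A \<subseteq> S" for A
        using that fin by (rule finite_subset)
      have "(\<Sum>A\<in>Pow S. gsign A (S - A) *
            (\<Sum>B\<in>Pow A. gsign B (A - B) * f B * g (A - B)) * h (S - A)) =
          (\<Sum>(A, B)\<in>Sigma (Pow S) Pow.
            gsign A (S - A) * (gsign B (A - B) * f B * g (A - B)) * h (S - A))"
        by (simp add: sum_distrib_left sum_distrib_right)
           (rule sum.Sigma, use fin fin' in auto)
      also have "\<dots> = (\<Sum>(B, C)\<in>Sigma (Pow S) (\<lambda>B. Pow (S - B)).
            gsign B (S - B) * f B * (gsign C (S - B - C) * g C * h (S - B - C)))"
      proof (rule sum.reindex_bij_witness
          [where j = "\<lambda>(A, B). (B, A - B)" and i = "\<lambda>(B, C). (B \<union> C, B)"])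
        fix x assume "x \<in> Sigma (Pow S) Pow"
        then obtain A B where x: "x = (A, B)" and A: "A \<subseteq> S" and B: "B \<subseteq> A" by auto
        have 1: "gsign A (S - A) = (gsign B (S - A) * gsign (A - B) (S - A) :: 'a)"
        proof -
          have "gsign (B \<union> (A - B)) (S - A) = (gsign B (S - A) * gsign (A - B) (S - A) :: 'a)"
            by (rule gsign_Un_left) (use A B in \<open>auto intro: fin'\<close>)
          moreover have "B \<union> (A - B) = A" using B by auto
          ultimately show ?thesis by simp
        qed
        have 2: "gsign B (S - B) = (gsign B (A - B) * gsign B (S - A) :: 'a)"
        proof -
          have "gsign B ((A - B) \<union> (S - A)) = (gsign B (A - B) * gsign B (S - A) :: 'a)"
            by (rule gsign_Un_right) (use A B in \<open>auto intro: fin'\<close>)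
          moreover have "(A - B) \<union> (S - A) = S - B" using A B by auto
          ultimately show ?thesis by simp
        qed
        have 3: "S - B - (A - B) = S - A" using A B by auto
        show "(case case x of (A, B) \<Rightarrow> (B, A - B) of (B, C) \<Rightarrow>
            gsign B (S - B) * f B * (gsign C (S - B - C) * g C * h (S - B - C))) =
          (case x of (A, B) \<Rightarrow>
            gsign A (S - A) * (gsign B (A - B) * f B * g (A - B)) * h (S - A))"
          by (simp add: x 1 2 3 mult_ac)
      qed auto
      also have "\<dots> = (\<Sum>B\<in>Pow S. gsign B (S - B) * f B *
            (\<Sum>C\<in>Pow (S - B). gsign C (S - B - C) * g C * h (S - B - C)))"
        by (simp add: sum_distrib_left)
           (rule sum.Sigma [symmetric], use fin in auto)
      finally show ?thesis .
    qed simp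
  qed
qed

end

lift_definition gscale :: "'k::field \<Rightarrow> 'k grassmann \<Rightarrow> 'k grassmann"
  is "\<lambda>c f A. c * f A"
proof -
  fix c and f :: "nat set \<Rightarrow> 'k"
  assume f: "finite {A. f A \<noteq> 0} \<and> (\<forall>A. infinite A \<longrightarrow> f A = 0)"
  moreover have "finite {A. c * f A \<noteq> 0}"
  proof (rule finite_subset)
    show "{A. c * f A \<noteq> 0} \<subseteq> {A. f A \<noteq> 0}" by auto
  qed (use f in simp)
  ultimately show "finite {A. c * f A \<noteq> 0} \<and> (\<forall>A. infinite A \<longrightarrow> c * f A = 0)"
    by simp
qed

lemma grassmann_eqI: "(\<And>A. coord f A = coord g A) \<Longrightarrow> f = g"
  by (simp add: coord_inject [symmetric] fun_eq_iff)

lemma coord_zero [simp]: "coord 0 A = 0"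
  by (simp add: zero_grassmann.rep_eq)

lemma coord_plus [simp]: "coord (f + g) A = coord f A + coord g A"
  by (simp add: plus_grassmann.rep_eq)

lemma coord_uminus [simp]: "coord (- f) A = - coord f A"
  by (simp add: uminus_grassmann.rep_eq)

lemma coord_gscale [simp]: "coord (gscale c f) A = c * coord f A"
  by (simp add: gscale.rep_eq)

lemma coord_mult:
  "coord (f * g) S = (\<Sum>A\<in>Pow S. gsign A (S - A) * coord f A * coord g (S - A))"
  by (simp add: times_grassmann.rep_eq)

lemma vector_space_gscale: "vector_space gscale"
  by unfold_locales (auto intro!: grassmann_eqI simp: algebra_simps)

lemma gscale_mult_left: "gscale c f * g = gscale c (f * g)"
  by (rule grassmann_eqI) (simp add: coord_mult sum_distrib_left mult.assoc mult.left_commute)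

lemma gscale_mult_right: "f * gscale c g = gscale c (f * g)"
  by (rule grassmann_eqI) (simp add: coord_mult sum_distrib_left mult.assoc mult.left_commute)

definition T_G :: "'k::field free_alg set" where
  "T_G = {f. \<forall>\<phi> :: 'k free_alg \<Rightarrow> 'k grassmann. unital_alg_hom fscale gscale \<phi> \<longrightarrow> \<phi> f = 0}"

lemma T_ideal_T_G: "T_ideal (T_G :: 'k::field free_alg set)"
  unfolding T_ideal_def
proof (intro conjI ballI allI impI)
  have hom: "\<phi> 0 = 0" "\<phi> (f + g) = \<phi> f + \<phi> g" "\<phi> (f * g) = \<phi> f * \<phi> g"
    if "unital_alg_hom fscale gscale \<phi>" for \<phi> :: "'k free_alg \<Rightarrow> 'k grassmann" and f g
  proof -
    from that interpret Vector_Spaces.linear fscale gscale \<phi>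
      by (simp add: unital_alg_hom_def)
    show "\<phi> 0 = 0" by (rule zero)
    show "\<phi> (f + g) = \<phi> f + \<phi> g" by (rule add)
    show "\<phi> (f * g) = \<phi> f * \<phi> g"
      using that by (simp add: unital_alg_hom_def)
  qed
  show "(0 :: 'k free_alg) \<in> T_G"
    by (simp add: T_G_def hom)
  show "f + g \<in> T_G" if "f \<in> T_G" "g \<in> T_G" for f g :: "'k free_alg"
    using that by (auto simp: T_G_def hom)
  show "g * f \<in> T_G" "f * g \<in> T_G" if "f \<in> T_G" for f g :: "'k free_alg"
    using that by (auto simp: T_G_def hom)
  show "\<psi> ` T_G \<subseteq> (T_G :: 'k free_alg set)"
    if \<psi>: "unital_alg_hom fscale fscale \<psi>" for \<psi> :: "'k free_alg \<Rightarrow> 'k free_alg"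
  proof -
    have "unital_alg_hom fscale gscale (\<phi> \<circ> \<psi>)"
      if "unital_alg_hom fscale gscale \<phi>" for \<phi> :: "'k free_alg \<Rightarrow> 'k grassmann"
      using that \<psi> by (auto simp: unital_alg_hom_def intro: Vector_Spaces.linear_compose)
    then show ?thesis
      by (fastforce simp: T_G_def)
  qed
qed

subsection \<open>Generators, relations and basis\<close>

text \<open>
  The generators satisfy the defining relations, and the products of generators with strictly
  increasing indices form a linear basis.
\<close>

lift_definition gmon :: "nat set \<Rightarrow> 'k::field grassmann"
  is "\<lambda>A B. if finite A \<and> B = A then 1 else 0"
  by auto

lemma coord_gmon: "coord (gmon A) B = (if finite A \<and> B = A then 1 else 0)"
  by (simp add: gmon.rep_eq)

definition gen :: "nat \<Rightarrow> 'k::field grassmann" where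
  "gen i = gmon {i}"

lemma gmon_empty: "gmon {} = 1"
  by (rule grassmann_eqI) (simp add: coord_gmon one_grassmann.rep_eq)

lemma gmon_mult:
  assumes "finite A" "finite B"
  shows "gmon A * gmon B =
    (if A \<inter> B = {} then gscale (gsign A B) (gmon (A \<union> B)) else (0::'k::field grassmann))"
proof -
  have "(\<Sum>C\<in>Pow S. gsign C (S - C) * (if finite A \<and> C = A then 1 else 0) *
      (if finite B \<and> S - C = B then 1 else 0)) =
      (if A \<inter> B = {} then gsign A B * (if finite (A \<union> B) \<and> S = A \<union> B then 1 else 0)
       else (0::'k))" (is "?l = ?r") for S
  proof (cases "finite S \<and> A \<subseteq> S")
    case True
    then have "?l = (\<Sum>C\<in>{A}. gsign C (S - C) * (if finite A \<and> C = A then 1 else 0) *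
      (if finite B \<and> S - C = B then 1 else 0))"
      by (intro sum.mono_neutral_right) auto
    also have "\<dots> = ?r"
      using assms True by auto
    finally show ?thesis .
  next
    case False
    then have "?l = 0"
      by (intro sum.neutral) (use False in \<open>auto simp: infinite_super\<close>)
    moreover have "?r = 0"
      using assms False by auto
    ultimately show ?thesis by simp
  qed
  then have "coord (gmon A * gmon B) S =
    coord (if A \<inter> B = {} then gscale (gsign A B) (gmon (A \<union> B)) else (0::'k grassmann)) S" for S
    by (simp add: coord_mult coord_gmon)
  then show ?thesis
    by (rule grassmann_eqI)
qed

lemma gen_square: "gen i * gen i = 0"
  by (simp add: gen_def gmon_mult)

lemma gen_anticommute: "gen i * gen j = - (gen j * gen i)"
proof -
  have sgn: "gsign {i} {j} = (if j < i then - 1 else (1::'k::field))" for i j :: nat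
  proof -
    have "{(a, b). a \<in> {i} \<and> b \<in> {j} \<and> b < a} = (if j < i then {(i, j)} else {})"
      by auto
    then show ?thesis
      unfolding gsign_def by simp
  qed
  show ?thesis
    unfolding gen_def
    by (rule grassmann_eqI) (auto simp: gmon_mult sgn insert_commute)
qed

lemma prod_list_gen:
  assumes "sorted_wrt (<) is"
  shows "prod_list (map gen is) = (gmon (set is) :: 'k::field grassmann)"
  using assms
proof (induction "is")
  case Nil
  then show ?case by (simp add: gmon_empty)
next
  case (Cons i "is")
  have "{(a, b). a \<in> {i} \<and> b \<in> set is \<and> b < a} = {}"
    using Cons.prems by auto
  then have "gsign {i} (set is) = (1::'k)"
    by (simp only: gsign_def card.empty power_0)
  moreover have "i \<notin> set is"
    using Cons.prems by auto
  moreover have "gscale 1 f = f" for f :: "'k grassmann"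
    by (rule grassmann_eqI) simp
  ultimately show ?case
    using Cons by (simp add: gmon_mult gen_def)
qed

lemma coord_sum_gscale_gmon:
  assumes "finite F" "F \<subseteq> Collect finite"
  shows "coord (\<Sum>A\<in>F. gscale (u A) (gmon A)) B = (if B \<in> F then u B else (0::'k::field))"
  using assms
  by (induction F rule: finite_induct)
     (auto simp: coord_gmon)

lemma gmon_expansion: "f = (\<Sum>A\<in>{A. coord f A \<noteq> 0}. gscale (coord f A) (gmon A))"
proof -
  have "finite {A. coord f A \<noteq> 0}" "{A. coord f A \<noteq> 0} \<subseteq> Collect finite"
    using coord [of f] by auto
  from coord_sum_gscale_gmon [OF this, of "coord f"] show ?thesis
    by (intro grassmann_eqI) simp
qed

lemma gmon_linear_independent:
  assumes "finite F" "F \<subseteq> Collect finite" "(\<Sum>A\<in>F. gscale (u A) (gmon A)) = 0" "A \<in> F"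
  shows "u A = (0::'k::field)"
  using coord_sum_gscale_gmon [OF assms(1,2), of u A] assms(3,4)
  by simp

end

theory Submission
  imports Defs "HOL-Library.Multiset" "HOL-Library.FuncSet"
    "HOL-Computational_Algebra.Polynomial"
begin

text \<open>
  Modulo the identities, commutators are central and \<open>[a, b][c, d] = - [a, c][b, d]\<close>.  Hence every
  element of the free algebra is congruent to a linear combination of normal monomials
  \<open>x\<^sub>0\<^bsup>a\<^sub>0\<^esup> \<cdots> [x\<^bsub>i1\<^esub>, x\<^bsub>i2\<^esub>] [x\<^bsub>i3\<^esub>, x\<^bsub>i4\<^esub>] \<cdots>\<close> with increasing indices in the commutators and
  exponents below \<open>q p\<close>.  These are linearly independent as functions on the Grassmann
  algebra: take a set \<open>S\<close> of indices, minimal among the commutator parts that occur, and evaluate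
  at \<open>x\<^sub>i = c\<^sub>i + g\<^sub>i + e\<^sub>i\<close> for \<open>i \<in> S\<close> and \<open>x\<^sub>i = c\<^sub>i + g\<^sub>i\<close> otherwise, where \<open>c\<^sub>i\<close> is a scalar and
  \<open>g\<^sub>i\<close> is a sum of \<open>p - 1\<close> products of two fresh generators, so that \<open>g\<^sub>i\<^bsup>p - 1\<^esup> \<noteq> 0 = g\<^sub>i\<^bsup>p\<^esup>\<close>.
  This kills every normal monomial whose commutators involve an index outside \<open>S\<close>.  In each variable
  and each coordinate, the remaining coefficients form a polynomial of degree less than \<open>q p\<close> that
  has a zero of order at least \<open>p\<close> at all \<open>q\<close> elements of the field.
\<close>

section \<open>Identities of the Grassmann algebra\<close>

definition central :: "'a::ring_1 \<Rightarrow> bool" where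
  "central x \<longleftrightarrow> (\<forall>y. x * y = y * x)"

lemma centralD: "central x \<Longrightarrow> x * y = y * x"
  by (simp add: central_def)

lemma central_add: "central x \<Longrightarrow> central y \<Longrightarrow> central (x + y)"
  by (simp add: central_def algebra_simps)

lemma central_1: "central 1"
  by (simp add: central_def)

lemma central_0: "central 0"
  by (simp add: central_def)

text \<open>The binomial expansion stops after its linear term. The exponent is a successor, so that
  no truncated subtraction occurs in \<open>y ^ n\<close>.\<close>

lemma power_add_square_zero:
  fixes y z :: "'a::ring_1"
  assumes comm: "y * z = z * y" and sq: "z * z = 0"
  shows "(y + z) ^ Suc n = y ^ Suc n + of_nat (Suc n) * y ^ n * z"
proof (induction n)
  case 0
  then show ?case by simp
next
  case (Suc n)
  have zy: "z * y ^ m = y ^ m * z" for m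
    using comm by (simp add: power_commuting_commutes)
  have "(y + z) ^ Suc (Suc n) = (y + z) * (y ^ Suc n + of_nat (Suc n) * y ^ n * z)"
    by (simp only: power_Suc [of _ "Suc n"] Suc.IH)
  also have "\<dots> = y ^ Suc (Suc n) + y * (of_nat (Suc n) * y ^ n * z) + z * y ^ Suc n
      + z * (of_nat (Suc n) * y ^ n * z)"
    by (simp add: algebra_simps)
  also have "z * (of_nat (Suc n) * y ^ n * z) = of_nat (Suc n) * (z * y ^ n) * z"
    by (metis mult.assoc mult_of_nat_commute)
  also have "\<dots> = 0"
    by (simp only: zy mult.assoc sq mult_zero_right)
  also have "y * (of_nat (Suc n) * y ^ n * z) = of_nat (Suc n) * y ^ Suc n * z"
    by (metis mult.assoc mult_of_nat_commute power_Suc)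
  finally show ?case
    by (simp only: zy) (simp add: algebra_simps)
qed

section \<open>Scalars and coordinates in the Grassmann algebra\<close>

lemma gscale_0_left [simp]: "gscale 0 f = 0"
  and gscale_0_right [simp]: "gscale c 0 = 0"
  and gscale_1 [simp]: "gscale 1 f = f"
  and gscale_gscale [simp]: "gscale c (gscale d f) = gscale (c * d) f"
  and gscale_add_right: "gscale c (f + g) = gscale c f + gscale c g"
  and gscale_add_left: "gscale (c + d) f = gscale c f + gscale d f"
  by (auto intro!: grassmann_eqI simp: algebra_simps)

lemma gscale_sum_right: "gscale c (\<Sum>i\<in>I. f i) = (\<Sum>i\<in>I. gscale c (f i))"
  by (induction I rule: infinite_finite_induct) (simp_all add: gscale_add_right)

lemma gscale_eq_0_iff: "gscale c f = 0 \<longleftrightarrow> c = 0 \<or> f = 0"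
proof
  assume h: "gscale c f = 0"
  {
    assume "c \<noteq> 0"
    then have "f = gscale (inverse c) (gscale c f)"
      by simp
    also have "\<dots> = 0" by (simp add: h)
    finally have "f = 0" .
  }
  then show "c = 0 \<or> f = 0" by blast
qed auto

lemma gscale_1_power: "gscale c 1 ^ n = gscale (c ^ n) (1 :: 'k::field grassmann)"
  by (induction n) (simp_all add: gscale_mult_left mult.commute)

lemma of_nat_grassmann: "of_nat n = gscale (of_nat n) (1 :: 'k::field grassmann)"
  by (induction n) (simp_all add: gscale_add_left)

lemma central_gscale: "central f \<Longrightarrow> central (gscale c f)"
  by (simp add: central_def gscale_mult_left gscale_mult_right)

lemma central_sum: "(\<And>i. i \<in> I \<Longrightarrow> central (f i)) \<Longrightarrow> central (\<Sum>i\<in>I. f i)"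
  by (induction I rule: infinite_finite_induct) (simp_all add: central_0 central_add)

lemma coord_infinite: "infinite A \<Longrightarrow> coord f A = 0"
  using coord [of f] by auto

lemma coord_sum: "coord (\<Sum>i\<in>I. f i) A = (\<Sum>i\<in>I. coord (f i) A)"
  by (induction I rule: infinite_finite_induct) simp_all

section \<open>Parity, centrality and commutators\<close>

text \<open>Each pair in \<open>A \<times> B\<close> is an inversion for exactly one of the two
  orders, so the two exponents add up to \<open>card A * card B\<close>.\<close>

lemma gsign_swap:
  assumes "finite A" "finite B" "A \<inter> B = {}"
  shows "gsign B A = (- 1) ^ (card A * card B) * (gsign A B :: 'k::ring_1)"
proof -
  let ?X = "{(a, b). a \<in> A \<and> b \<in> B \<and> b < a}" and ?Y = "{(b, a). b \<in> B \<and> a \<in> A \<and> a < b}"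
  have "A \<times> B = ?X \<union> prod.swap ` ?Y"
    using assms(3) by (auto simp: image_iff)
  then have "card A * card B = card (?X \<union> prod.swap ` ?Y)"
    by (simp add: card_cartesian_product [symmetric])
  also have "\<dots> = card ?X + card (prod.swap ` ?Y)"
    by (rule card_Un_disjoint) (use assms in \<open>auto intro: finite_inversions\<close>)
  also have "card (prod.swap ` ?Y) = card ?Y"
    by (rule card_image) simp
  finally have "card A * card B = card ?X + card ?Y" .
  moreover have "(- 1) ^ (x + y) * (- 1) ^ x = ((- 1) ^ y :: 'k)" for x y :: nat
    by (cases "even x"; cases "even y") simp_all
  ultimately show ?thesis
    by (simp add: gsign_def)
qed

definition even_elem :: "'k::field grassmann \<Rightarrow> bool" where
  "even_elem f \<longleftrightarrow> (\<forall>A. coord f A \<noteq> 0 \<longrightarrow> even (card A))"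

definition odd_elem :: "'k::field grassmann \<Rightarrow> bool" where
  "odd_elem f \<longleftrightarrow> (\<forall>A. coord f A \<noteq> 0 \<longrightarrow> odd (card A))"

text \<open>Complementation in \<open>S\<close> matches the terms of the two products up to the sign
  of \<open>gsign_swap\<close>. One common sign \<open>u\<close> covers three situations: an even
  factor, two odd factors, and characteristic 2.\<close>

lemma mult_swap_coord:
  fixes f g :: "'k::field grassmann"
  assumes sign: "\<And>A B. finite A \<Longrightarrow> finite B \<Longrightarrow> coord f A \<noteq> 0 \<Longrightarrow> coord g B \<noteq> 0 \<Longrightarrow>
    (- 1) ^ (card A * card B) = u"
  shows "g * f = gscale u (f * g)"
proof (rule grassmann_eqI)
  fix S :: "nat set"
  show "coord (g * f) S = coord (gscale u (f * g)) S"
  proof (cases "finite S")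
    case False
    then show ?thesis by (simp add: coord_infinite)
  next
    case True
    have "(\<Sum>A\<in>Pow S. gsign A (S - A) * coord g A * coord f (S - A)) =
      (\<Sum>A\<in>Pow S. u * (gsign A (S - A) * coord f A * coord g (S - A)))"
    proof (rule sum.reindex_bij_witness [where i = "\<lambda>A. S - A" and j = "\<lambda>A. S - A"])
      fix A assume A: "A \<in> Pow S"
      then have *: "S - (S - A) = A" "finite A" "finite (S - A)" "(S - A) \<inter> A = {}"
        using True finite_subset by auto
      show "u * (gsign (S - A) (S - (S - A)) * coord f (S - A) * coord g (S - (S - A))) =
          gsign A (S - A) * coord g A * coord f (S - A)"
      proof (cases "coord f (S - A) = 0 \<or> coord g A = 0")
        case False
        then show ?thesis
          using sign [OF *(3,2)] gsign_swap [OF *(3,2,4), where 'k = 'k] by (simp add: *(1))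
      qed (auto simp: *(1))
    qed auto
    then show ?thesis
      by (simp add: coord_mult sum_distrib_left)
  qed
qed

lemma even_elem_central: "even_elem f \<Longrightarrow> central f"
  unfolding central_def
  using mult_swap_coord [of f _ 1] by (auto simp: even_elem_def)

lemma odd_elem_anticommute: "odd_elem f \<Longrightarrow> odd_elem g \<Longrightarrow> g * f = - (f * g)"
  using mult_swap_coord [of f g "- 1"]
  by (auto simp: odd_elem_def intro!: grassmann_eqI)

lemma even_elem_mult_odd:
  assumes "odd_elem f" "odd_elem g"
  shows "even_elem (f * g)"
  unfolding even_elem_def
proof (intro allI impI)
  fix S assume S: "coord (f * g) S \<noteq> 0"
  then have fin: "finite S"
    using coord_infinite by blast
  from S obtain A where "A \<in> Pow S" "gsign A (S - A) * coord f A * coord g (S - A) \<noteq> 0"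
    unfolding coord_mult by (rule sum.not_neutral_contains_not_neutral)
  then have "A \<subseteq> S" "coord f A \<noteq> 0" "coord g (S - A) \<noteq> 0"
    by simp_all
  then have "A \<subseteq> S" "odd (card A)" "odd (card (S - A))"
    using assms by (simp_all add: odd_elem_def)
  moreover from this have "card (A \<union> (S - A)) = card A + card (S - A)"
    using fin by (intro card_Un_disjoint) (auto intro: finite_subset)
  ultimately show "even (card S)"
    by (simp add: Un_absorb1)
qed

lemma central_char_2:
  assumes "CHAR('k::field) = 2"
  shows "central (f :: 'k grassmann)"
proof -
  have m1: "(- 1) = (1 :: 'k)"
    using of_nat_CHAR [where 'a = 'k] assms by (simp add: neg_eq_iff_add_eq_0)
  have "g * f = gscale 1 (f * g)" for g
    by (intro mult_swap_coord) (simp only: m1 power_one)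
  then show ?thesis
    by (simp add: central_def)
qed

lift_definition gpart :: "(nat set \<Rightarrow> bool) \<Rightarrow> 'k::field grassmann \<Rightarrow> 'k grassmann"
  is "\<lambda>P f A. if P A then f A else 0"
proof (intro conjI allI impI)
  fix P and f :: "nat set \<Rightarrow> 'k"
  assume f: "finite {A. f A \<noteq> 0} \<and> (\<forall>A. infinite A \<longrightarrow> f A = 0)"
  show "finite {A. (if P A then f A else 0) \<noteq> 0}"
    by (rule finite_subset [of _ "{A. f A \<noteq> 0}"]) (use f in auto)
qed auto

lemma coord_gpart: "coord (gpart P f) A = (if P A then coord f A else 0)"
  by (simp add: gpart.rep_eq)

lemma even_odd_decomp:
  obtains f0 f1 where "f = f0 + f1" "even_elem f0" "odd_elem f1"
proof
  show "f = gpart (\<lambda>A. even (card A)) f + gpart (\<lambda>A. odd (card A)) f"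
    by (rule grassmann_eqI) (simp add: coord_gpart)
qed (auto simp: even_elem_def odd_elem_def coord_gpart)

lemma comm_add_central:
  assumes "central x" "central y"
  shows "comm (x + a) (y + b) = comm a b"
  using centralD [OF assms(1), of y] centralD [OF assms(1), of b] centralD [OF assms(2), of a]
  by (simp add: comm_def algebra_simps)

text \<open>Even parts are central and drop out of the commutator, which leaves twice the product of
  the odd parts.\<close>

lemma even_elem_comm:
  fixes f g :: "'k::field grassmann"
  shows "even_elem (comm f g)"
proof -
  obtain f0 f1 where f: "f = f0 + f1" "even_elem f0" "odd_elem f1"
    by (rule even_odd_decomp)
  obtain g0 g1 where g: "g = g0 + g1" "even_elem g0" "odd_elem g1"
    by (rule even_odd_decomp)
  have "comm f g = comm f1 g1"
    using f g by (simp add: comm_add_central even_elem_central)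
  also have "\<dots> = f1 * g1 + f1 * g1"
    using odd_elem_anticommute [OF f(3) g(3)] by (simp add: comm_def)
  finally show ?thesis
    using even_elem_mult_odd [OF f(3) g(3)] by (simp add: even_elem_def)
qed

lemma comm_comm_grassmann: "comm (comm f g) h = (0 :: 'k::field grassmann)"
  using centralD [OF even_elem_central [OF even_elem_comm], of f g h]
  by (simp add: comm_def [of "comm f g" h])

section \<open>The p-th power map of the Grassmann algebra\<close>

lemma even_elem_gmon: "even (card A) \<Longrightarrow> even_elem (gmon A)"
  by (simp add: even_elem_def coord_gmon)

lemma gmon_square: "A \<noteq> {} \<Longrightarrow> gmon A * gmon A = (0 :: 'k::field grassmann)"
proof (cases "finite A")
  case False
  then have "gmon A = (0 :: 'k grassmann)"
    by (intro grassmann_eqI) (simp add: coord_gmon)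
  then show ?thesis by simp
qed (simp add: gmon_mult)

lemma power_CHAR_add_square_zero:
  fixes y z :: "'k::field_prime_char grassmann"
  assumes "y * z = z * y" "z * z = 0"
  shows "(y + z) ^ CHAR('k) = y ^ CHAR('k)"
proof -
  have "CHAR('k) \<noteq> 0"
    using CHAR_prime [where 'a = 'k] by (rule prime_gt_0_nat [THEN gr_implies_not0])
  then obtain n where n: "CHAR('k) = Suc n"
    using not0_implies_Suc by blast
  have "of_nat (Suc n) = (0 :: 'k)"
    unfolding n [symmetric] by (rule of_nat_CHAR)
  then have "of_nat (Suc n) = (0 :: 'k grassmann)"
    by (simp only: of_nat_grassmann gscale_0_left)
  then show ?thesis
    unfolding n power_add_square_zero [OF assms] by (simp only: mult_zero_left add_0_right)
qed

lemma two_neq_zero_of_CHAR: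
  assumes "CHAR('k::field_prime_char) \<noteq> 2"
  shows "(2 :: 'k) \<noteq> 0"
proof -
  have "(of_nat 2 :: 'k) \<noteq> 0"
    using assms by (metis CHAR_prime of_nat_eq_0_iff_char_dvd primes_dvd_imp_eq two_is_prime_nat)
  then show ?thesis by simp
qed

text \<open>All terms except the constant one can be removed under the p-th power: \<open>z\<close>
  squares to zero, and the monomials indexed by \<open>E\<close> are central with square zero, so
  \<open>power_CHAR_add_square_zero\<close> strips them off one at a time.\<close>

lemma grassmann_power_CHAR:
  fixes f :: "'k::field_prime_char grassmann"
  shows "f ^ CHAR('k) = gscale (coord f {} ^ CHAR('k)) 1"
proof -
  let ?p = "CHAR('k)"
  \<comment> \<open>In characteristic 2 the odd monomials are central too and join \<open>E\<close>.
    Otherwise they are collected in \<open>z\<close>, whose square vanishes by anticommutation and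
    division by 2.\<close>
  define E where "E = {A. coord f A \<noteq> 0 \<and> A \<noteq> {} \<and> (even (card A) \<or> ?p = 2)}"
  define z where "z = gpart (\<lambda>A. odd (card A) \<and> ?p \<noteq> 2) f"
  have finE: "finite E"
    by (rule finite_subset [of _ "{A. coord f A \<noteq> 0}"]) (use coord [of f] in \<open>auto simp: E_def\<close>)
  have finA: "finite A" if "A \<in> E" for A
    using that coord_infinite [of A f] by (auto simp: E_def)
  have f_eq: "f = gscale (coord f {}) 1 + z + (\<Sum>A\<in>E. gscale (coord f A) (gmon A))"
  proof (rule grassmann_eqI)
    fix B
    have "coord (\<Sum>A\<in>E. gscale (coord f A) (gmon A)) B = (if B \<in> E then coord f B else 0)"
      by (rule coord_sum_gscale_gmon) (use finE finA in auto)
    then show "coord f B =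
        coord (gscale (coord f {}) 1 + z + (\<Sum>A\<in>E. gscale (coord f A) (gmon A))) B"
      by (auto simp: z_def coord_gpart E_def one_grassmann.rep_eq)
  qed
  have zz: "z * z = 0"
  proof (cases "?p = 2")
    case True
    then have "z = 0"
      by (intro grassmann_eqI) (simp add: z_def coord_gpart)
    then show ?thesis by simp
  next
    case False
    have "odd_elem z"
      by (simp add: z_def odd_elem_def coord_gpart)
    then have "z * z = - (z * z)"
      by (intro odd_elem_anticommute)
    then have "gscale 2 (z * z) = 0"
      by (metis add.right_inverse gscale_add_left gscale_1 one_add_one)
    with False show ?thesis
      by (simp add: gscale_eq_0_iff two_neq_zero_of_CHAR)
  qed
  have "(gscale (coord f {}) 1 + z + (\<Sum>A\<in>F. gscale (coord f A) (gmon A))) ^ ?p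
      = gscale (coord f {} ^ ?p) 1" if "F \<subseteq> E" for F
    using finite_subset [OF that finE] that
  proof (induction F rule: finite_induct)
    case empty
    show ?case
      using power_CHAR_add_square_zero [of "gscale (coord f {}) 1" z] zz
      by (simp add: gscale_mult_left gscale_mult_right gscale_1_power)
  next
    case (insert A F)
    have "central (gmon A :: 'k grassmann)"
      using insert.prems by (auto simp: E_def intro: even_elem_central even_elem_gmon central_char_2)
    then have "central (gscale (coord f A) (gmon A))"
      by (rule central_gscale)
    then have "((gscale (coord f {}) 1 + z + (\<Sum>A\<in>F. gscale (coord f A) (gmon A)))
        + gscale (coord f A) (gmon A)) ^ ?p =
        (gscale (coord f {}) 1 + z + (\<Sum>A\<in>F. gscale (coord f A) (gmon A))) ^ ?p"
      using insert.prems
      by (intro power_CHAR_add_square_zero centralD [symmetric])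
         (auto simp: gscale_mult_left gscale_mult_right gmon_square E_def)
    with insert show ?case
      by (simp add: add_ac)
  qed
  from this [of E] f_eq show ?thesis by simp
qed

section \<open>Reduction to normal monomials\<close>

lemma free_alg_expansion:
  "f = (\<Sum>w\<in>Poly_Mapping.keys f. Poly_Mapping.single w (Poly_Mapping.lookup f w))"
  by (rule poly_mapping_eqI)
     (simp add: lookup_sum lookup_single when_def not_in_keys_iff_lookup_eq_zero)

lemma free_alg_induct [case_names zero add single]:
  fixes f :: "'k::field free_alg"
  assumes "P 0" "\<And>f g. P f \<Longrightarrow> P g \<Longrightarrow> P (f + g)" "\<And>w c. P (Poly_Mapping.single w c)"
  shows "P f"
proof -
  have "P (\<Sum>w\<in>W. Poly_Mapping.single w (Poly_Mapping.lookup f w))" if "finite W" for W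
    using that by (induction W rule: finite_induct) (simp_all add: assms)
  then show ?thesis
    by (subst free_alg_expansion) simp
qed

lemma single_Word: "Poly_Mapping.single (Word w) 1 = (prod_list (map var w) :: 'k::field free_alg)"
proof (induction w)
  case Nil
  then show ?case by (simp add: zero_free_monoid_def [symmetric])
next
  case (Cons i w)
  have "var i * Poly_Mapping.single (Word w) 1 = (Poly_Mapping.single (Word (i # w)) 1 :: 'k free_alg)"
    by (simp add: var_def mult_single plus_free_monoid_def)
  with Cons show ?case by simp
qed

lemma single_eq_fscale: "Poly_Mapping.single w c = fscale c (Poly_Mapping.single w 1)"
  by (rule poly_mapping_eqI) (simp add: lookup_single when_def)

text \<open>The homomorphism given by the universal property of the free algebra. The target is left
  open because both substitutions in the free algebra and evaluations in the Grassmann algebra are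
  needed.\<close>

definition feval :: "('k::field \<Rightarrow> 'b::ring_1 \<Rightarrow> 'b) \<Rightarrow> (nat \<Rightarrow> 'b) \<Rightarrow> 'k free_alg \<Rightarrow> 'b" where
  "feval s \<sigma> f =
    (\<Sum>w\<in>Poly_Mapping.keys f. s (Poly_Mapping.lookup f w) (prod_list (map \<sigma> (letters w))))"

locale unital_algebra = vector_space s
  for s :: "'k::field \<Rightarrow> 'b::ring_1 \<Rightarrow> 'b" +
  assumes s_mult_left: "s c x * y = s c (x * y)"
    and s_mult_right: "x * s c y = s c (x * y)"
begin

lemma feval_superset:
  assumes "finite K" "Poly_Mapping.keys f \<subseteq> K"
  shows "feval s \<sigma> f = (\<Sum>w\<in>K. s (Poly_Mapping.lookup f w) (prod_list (map \<sigma> (letters w))))"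
  unfolding feval_def
  by (rule sum.mono_neutral_left) (use assms in \<open>auto simp: not_in_keys_iff_lookup_eq_zero\<close>)

lemma feval_add: "feval s \<sigma> (f + g) = feval s \<sigma> f + feval s \<sigma> g"
proof -
  let ?K = "Poly_Mapping.keys f \<union> Poly_Mapping.keys g"
  have "feval s \<sigma> h = (\<Sum>w\<in>?K. s (Poly_Mapping.lookup h w) (prod_list (map \<sigma> (letters w))))"
    if "h \<in> {f, g, f + g}" for h
    by (rule feval_superset) (use that keys_add [of f g] in auto)
  then show ?thesis
    by (simp add: lookup_add scale_left_distrib sum.distrib)
qed

lemma feval_single: "feval s \<sigma> (Poly_Mapping.single w c) = s c (prod_list (map \<sigma> (letters w)))"
  by (subst feval_superset [of "{w}"]) auto

lemma feval_0: "feval s \<sigma> 0 = 0"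
  by (simp add: feval_def)

lemma feval_mult: "feval s \<sigma> (f * g) = feval s \<sigma> f * feval s \<sigma> g"
proof (induction f rule: free_alg_induct)
  case (single v c)
  show ?case
    by (induction g rule: free_alg_induct)
       (simp_all add: feval_0 feval_add feval_single distrib_left mult_single plus_free_monoid_def
         s_mult_left s_mult_right)
qed (simp_all add: feval_0 feval_add distrib_right)

lemma feval_fscale: "feval s \<sigma> (fscale c f) = s c (feval s \<sigma> f)"
  by (simp add: fscale_eq_mult feval_mult feval_single zero_free_monoid_def s_mult_left)

lemma unital_alg_hom_feval: "unital_alg_hom fscale s (feval s \<sigma>)"
  using vector_space_fscale vector_space_axioms feval_single [of \<sigma> 0 1]
  by (simp add: unital_alg_hom_def Vector_Spaces.linear_iff feval_add feval_mult feval_fscale)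
     (simp add: zero_free_monoid_def)

lemma feval_var: "feval s \<sigma> (var i) = \<sigma> i"
  by (simp add: var_def feval_single)

end

interpretation free_alg: unital_algebra "fscale :: 'k::field \<Rightarrow> _"
proof -
  have "f * fscale c g = fscale c (f * g)" for c and f g :: "'k free_alg"
  proof -
    have "f * Poly_Mapping.single 0 c = Poly_Mapping.single 0 c * f"
      by (induction f rule: free_alg_induct)
         (simp_all add: distrib_left distrib_right mult_single mult.commute)
    then show ?thesis
      unfolding fscale_eq_mult by (metis mult.assoc)
  qed
  then show "unital_algebra (fscale :: 'k \<Rightarrow> _)"
    using vector_space_fscale
    by (simp add: unital_algebra_def unital_algebra_axioms_def) (simp add: fscale_eq_mult mult.assoc)
qed

interpretation grassmann: unital_algebra "gscale :: 'k::field \<Rightarrow> _"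
  using vector_space_gscale
  by (simp add: unital_algebra_def unital_algebra_axioms_def gscale_mult_left gscale_mult_right)

lemma
  assumes "unital_alg_hom s1 s2 \<phi>"
  shows hom_diff: "\<phi> (a - b) = \<phi> a - \<phi> b"
    and hom_mult: "\<phi> (a * b) = \<phi> a * \<phi> b"
    and hom_one: "\<phi> 1 = 1"
    and hom_scale: "\<phi> (s1 c a) = s2 c (\<phi> a)"
    and hom_sum: "\<phi> (\<Sum>i\<in>A. f i) = (\<Sum>i\<in>A. \<phi> (f i))"
    and hom_power: "\<phi> (a ^ n) = \<phi> a ^ n"
    and hom_prod_list: "\<phi> (prod_list xs) = prod_list (map \<phi> xs)"
    and hom_comm: "\<phi> (comm a b) = comm (\<phi> a) (\<phi> b)"
proof -
  from assms interpret Vector_Spaces.linear s1 s2 \<phi>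
    by (simp add: unital_alg_hom_def)
  show "\<phi> (a - b) = \<phi> a - \<phi> b" by (rule diff)
  show "\<phi> (s1 c a) = s2 c (\<phi> a)" by (rule scale)
  show "\<phi> (\<Sum>i\<in>A. f i) = (\<Sum>i\<in>A. \<phi> (f i))" by (rule sum)
  have mult: "\<phi> (a * b) = \<phi> a * \<phi> b" for a b
    using assms by (simp add: unital_alg_hom_def)
  have one: "\<phi> 1 = 1"
    using assms by (simp add: unital_alg_hom_def)
  show "\<phi> (a * b) = \<phi> a * \<phi> b" "\<phi> 1 = 1"
    by (fact mult one)+
  show "\<phi> (a ^ n) = \<phi> a ^ n"
    by (induction n) (simp_all add: mult one)
  show "\<phi> (prod_list xs) = prod_list (map \<phi> xs)"
    by (induction xs) (simp_all add: mult one)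
  show "\<phi> (comm a b) = comm (\<phi> a) (\<phi> b)"
    by (simp add: comm_def diff mult)
qed

section \<open>Sorting by adjacent transpositions\<close>

lemma insort_adjacent_swap:
  fixes v :: "'a::linorder list"
  assumes swap: "\<And>u i j v. P (u @ j # i # v) \<Longrightarrow> P (u @ i # j # v)"
  shows "P (u @ insort x v) \<Longrightarrow> P (u @ x # v)"
proof (induction v arbitrary: u)
  case (Cons y v)
  show ?case
  proof (cases "x \<le> y")
    case False
    then have "P ((u @ [y]) @ insort x v)"
      using Cons.prems by simp
    then have "P ((u @ [y]) @ x # v)"
      by (rule Cons.IH)
    then show ?thesis
      using swap [of u y x v] by simp
  qed (use Cons.prems in simp)
qed simp

text \<open>Insertion sort only exchanges neighbours, so a property stable under such exchanges has
  to be checked on sorted lists alone. The prefix \<open>u\<close> makes room for the letters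
  already passed.\<close>

lemma sort_adjacent_swap:
  fixes w :: "'a::linorder list"
  assumes swap: "\<And>u i j v. P (u @ j # i # v) \<Longrightarrow> P (u @ i # j # v)"
  shows "P (u @ sort w) \<Longrightarrow> P (u @ w)"
proof (induction w arbitrary: u)
  case (Cons x w)
  from Cons.prems have "P (u @ insort x (sort w))"
    by simp
  with swap have "P (u @ x # sort w)"
    by (rule insort_adjacent_swap [of P])
  then have "P ((u @ [x]) @ sort w)"
    by simp
  then have "P ((u @ [x]) @ w)"
    by (rule Cons.IH)
  then show ?case by simp
qed simp

lemma sorted_not_distinct:
  fixes w :: "'a::linorder list"
  assumes "sorted w" "\<not> distinct w"
  obtains u x v where "w = u @ x # x # v"
  using assms
proof (induction w arbitrary: thesis)
  case (Cons y w)
  show ?case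
  proof (cases "distinct w")
    case True
    then obtain z w' where w: "w = z # w'"
      using Cons.prems by (cases w) auto
    moreover have "y = z"
      using Cons.prems True w by force
    ultimately show ?thesis
      using Cons.prems(1) [of "[]"] by simp
  next
    case False
    then obtain u x v where "w = u @ x # x # v"
      using Cons.IH Cons.prems by auto
    then show ?thesis
      using Cons.prems(1) [of "y # u"] by simp
  qed
qed simp

lemma sort_eq_concat_replicate:
  assumes "set w \<subseteq> {..<n::nat}"
  shows "sort w = concat (map (\<lambda>i. replicate (count_list w i) i) [0..<n])" (is "_ = ?c n")
proof (rule properties_for_sort)
  have "count_list (replicate k i) j = (if i = j then k else 0)" for k and i j :: nat
    by (induction k) auto
  then have "count_list (?c m) j = (if j < m then count_list w j else 0)" for m j
    by (induction m) (auto simp: less_Suc_eq)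
  moreover have "count_list w j = 0" if "\<not> j < n" for j
    using assms that by (auto simp: count_list_0_iff)
  ultimately show "mset (?c n) = mset w"
    by (intro multiset_eqI) (simp add: count_mset)
  show "sorted (?c n)"
    by (induction n) (auto simp: sorted_append)
qed

text \<open>Brings a sorted word into the power-product shape required by
  \<open>normal_monomial\<close>.\<close>

lemma prod_list_sort:
  assumes "set w \<subseteq> {..<n}"
  shows "prod_list (map x (sort w)) = prod_list (map (\<lambda>i. (x i :: 'a::monoid_mult) ^ count_list w i) [0..<n])"
proof -
  have "prod_list (map x (concat (map (\<lambda>i. replicate (c i) i) l))) = prod_list (map (\<lambda>i. x i ^ c i) l)"
    for c and l :: "nat list"
    by (induction l) simp_all
  then show ?thesis
    by (simp add: sort_eq_concat_replicate [OF assms])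
qed

section \<open>Products of commutators and normal monomials\<close>

text \<open>Letters are paired from the left, and an unpaired last letter contributes the factor 1.
  The normal monomials indexed by \<open>normal_index\<close> only involve lists of even
  length.\<close>

fun comm_list :: "(nat \<Rightarrow> 'a::ring_1) \<Rightarrow> nat list \<Rightarrow> 'a" where
  "comm_list x (i # j # s) = comm (x i) (x j) * comm_list x s"
| "comm_list x _ = 1"

definition normal_monomial :: "nat \<Rightarrow> (nat \<Rightarrow> 'a::ring_1) \<Rightarrow> (nat \<Rightarrow> nat) \<times> nat set \<Rightarrow> 'a" where
  "normal_monomial n x =
    (\<lambda>(a, S). prod_list (map (\<lambda>i. x i ^ a i) [0..<n]) * comm_list x (sorted_list_of_set S))"

text \<open>In characteristic \<open>2\<close> all commutators are identities, so only \<open>S = {}\<close> is needed.\<close>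

definition normal_index :: "'k::finite_field itself \<Rightarrow> nat \<Rightarrow> ((nat \<Rightarrow> nat) \<times> nat set) set" where
  "normal_index _ n = (PiE {..<n} (\<lambda>_. {..<CARD('k) * CHAR('k)})) \<times>
    {S. S \<subseteq> {..<n} \<and> even (card S) \<and> (CHAR('k) = 2 \<longrightarrow> S = {})}"

lemma finite_normal_index: "finite (normal_index TYPE('k::finite_field) n)"
  unfolding normal_index_def
  by (intro finite_cartesian_product finite_PiE) auto

section \<open>Consequences of the identities in a T-ideal\<close>

text \<open>A common interface for both generating sets of the theorem, so that the reduction is
  carried out once. The identities are stated for fixed variables; substitution extends them to all
  elements.\<close>

locale grassmann_identities =
  fixes I :: "'k::finite_field free_alg set"
  assumes T_ideal: "T_ideal I"
    and comm_comm_var: "comm (comm (var 0) (var 1)) (var 2) \<in> I"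
    and power_var: "var 0 ^ (CARD('k) * CHAR('k)) - var 0 ^ CHAR('k) \<in> I"
    and comm_var: "CHAR('k) = 2 \<Longrightarrow> comm (var 0) (var 1) \<in> I"
begin

lemma zero_in: "0 \<in> I"
  and add_in: "f \<in> I \<Longrightarrow> g \<in> I \<Longrightarrow> f + g \<in> I"
  and mult_left_in: "f \<in> I \<Longrightarrow> g * f \<in> I"
  and mult_right_in: "f \<in> I \<Longrightarrow> f * g \<in> I"
  using T_ideal by (auto simp: T_ideal_def)

lemma fscale_in: "f \<in> I \<Longrightarrow> fscale c f \<in> I"
  by (simp add: fscale_eq_mult mult_left_in)

lemma uminus_in: "f \<in> I \<Longrightarrow> - f \<in> I"
  using mult_left_in [of f "- 1"] by simp

lemma diff_in: "f \<in> I \<Longrightarrow> g \<in> I \<Longrightarrow> f - g \<in> I"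
  using add_in [of f "- g"] uminus_in [of g] by simp

lemma substitute_in: "f \<in> I \<Longrightarrow> feval fscale \<sigma> f \<in> I"
  using T_ideal free_alg.unital_alg_hom_feval [of \<sigma>] unfolding T_ideal_def by blast

lemma comm_comm_in: "comm (comm f g) h \<in> I"
  using substitute_in [OF comm_comm_var, of "\<lambda>i. if i = 0 then f else if i = 1 then g else h"]
  by (simp add: hom_comm [OF free_alg.unital_alg_hom_feval] free_alg.feval_var)

lemma power_in: "f ^ (CARD('k) * CHAR('k)) - f ^ CHAR('k) \<in> I"
  using substitute_in [OF power_var, of "\<lambda>_. f"]
  by (simp add: hom_diff [OF free_alg.unital_alg_hom_feval] hom_power [OF free_alg.unital_alg_hom_feval]
      free_alg.feval_var)

lemma comm_in: "CHAR('k) = 2 \<Longrightarrow> comm f g \<in> I"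
  using substitute_in [OF comm_var, of "\<lambda>i. if i = 0 then f else g"]
  by (simp add: hom_comm [OF free_alg.unital_alg_hom_feval] free_alg.feval_var)

text \<open>Expanding \<open>comm (comm (a * b) j) i\<close> by the Leibniz rule twice yields these
  two products, up to sign, besides multiples of triple commutators.\<close>

lemma comm_mult_comm_in: "comm a i * comm j b + comm a j * comm i b \<in> I"
proof -
  have "comm a i * comm j b + comm a j * comm i b =
      - (comm (comm (a * b) j) i - a * comm (comm b j) i - comm (comm a j) i * b)"
    by (simp add: comm_def algebra_simps)
  then show ?thesis
    by (simp only:) (intro uminus_in diff_in mult_left_in mult_right_in comm_comm_in)
qed

text \<open>The exchanged letters either form one commutator, whose antisymmetry is exact, or belong
  to two neighbouring ones, where \<open>comm_mult_comm_in\<close> applies. The other factors are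
  absorbed by the ideal.\<close>

lemma comm_list_swap_in:
  "even (length u + length v) \<Longrightarrow>
    comm_list x (u @ i # j # v) + comm_list x (u @ j # i # v) \<in> I"
proof (induction x u rule: comm_list.induct)
  case (1 x a b u)
  then show ?case
    using mult_left_in [of "comm_list x (u @ i # j # v) + comm_list x (u @ j # i # v)" "comm (x a) (x b)"]
    by (simp add: distrib_left)
next
  case ("2_1" x)
  have "comm (x i) (x j) * c + comm (x j) (x i) * c = 0" for c
    by (simp add: comm_def algebra_simps)
  then show ?case by (simp add: zero_in)
next
  case ("2_2" x a)
  \<comment> \<open>Here \<open>i\<close> is paired with \<open>a\<close>, and by parity
    \<open>v\<close> is nonempty, so that \<open>j\<close> has a partner \<open>b\<close>.\<close>
  then obtain b v' where v: "v = b # v'"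
    by (cases v) auto
  show ?case
    using mult_right_in [OF comm_mult_comm_in [of "x a" "x i" "x j" "x b"], of "comm_list x v'"]
    by (simp add: v distrib_right mult.assoc)
qed

lemma comm_list_char_2_in:
  assumes "CHAR('k) = 2" "even (length s)" "s \<noteq> []"
  shows "comm_list x s \<in> I"
proof -
  obtain i j s' where "s = i # j # s'"
    using assms(2,3) by (metis even_Suc length_Cons list.exhaust list.size(3) even_zero)
  then show ?thesis
    using assms by (simp add: comm_in mult_right_in)
qed

text \<open>In a sorted list equal letters are adjacent, and exchanging them shows that twice the
  product lies in \<open>I\<close>; 2 is invertible unless the characteristic is 2, where every
  nonempty product of commutators is in \<open>I\<close> anyway.\<close>

lemma comm_list_not_distinct_in:
  assumes "even (length s)" "sorted s" "\<not> distinct s"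
  shows "comm_list x s \<in> I"
proof (cases "CHAR('k) = 2")
  case True
  then show ?thesis
    using assms by (intro comm_list_char_2_in) auto
next
  case False
  then have two: "(2 :: 'k) \<noteq> 0"
    by (rule two_neq_zero_of_CHAR)
  from assms(2,3) obtain u i v where s: "s = u @ i # i # v"
    by (rule sorted_not_distinct)
  have "comm_list x s + comm_list x s \<in> I"
    using comm_list_swap_in [of u v x i i] assms(1) s by simp
  then have "fscale (inverse 2) (comm_list x s + comm_list x s) \<in> I"
    by (rule fscale_in)
  also have "fscale (inverse 2) (comm_list x s + comm_list x s) = comm_list x s"
  proof (rule poly_mapping_eqI)
    have "inverse 2 * (c + c) = c" for c :: 'k
      using two by (simp flip: mult_2)
    then show "Poly_Mapping.lookup (fscale (inverse 2) (comm_list x s + comm_list x s)) w =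
        Poly_Mapping.lookup (comm_list x s) w" for w
      by (simp only: lookup_fscale lookup_add)
  qed
  finally show ?thesis .
qed

section \<open>Rewriting into normal form\<close>

definition normalizable :: "nat \<Rightarrow> 'k free_alg \<Rightarrow> bool" where
  "normalizable n f \<longleftrightarrow> (\<exists>\<alpha>.
     f - (\<Sum>i\<in>normal_index TYPE('k) n. fscale (\<alpha> i) (normal_monomial n var i)) \<in> I)"

lemma normalizable_add:
  assumes "normalizable n f" "normalizable n g"
  shows "normalizable n (f + g)"
proof -
  from assms obtain \<alpha> \<beta> where
    \<alpha>: "f - (\<Sum>i\<in>normal_index TYPE('k) n. fscale (\<alpha> i) (normal_monomial n var i)) \<in> I" and
    \<beta>: "g - (\<Sum>i\<in>normal_index TYPE('k) n. fscale (\<beta> i) (normal_monomial n var i)) \<in> I"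
    by (auto simp: normalizable_def)
  have "f + g - (\<Sum>i\<in>normal_index TYPE('k) n. fscale (\<alpha> i + \<beta> i) (normal_monomial n var i)) \<in> I"
    using add_in [OF \<alpha> \<beta>]
    by (simp add: free_alg.scale_left_distrib sum.distrib algebra_simps)
  then show ?thesis
    unfolding normalizable_def by (rule exI [of _ "\<lambda>i. \<alpha> i + \<beta> i"])
qed

lemma normalizable_fscale:
  assumes "normalizable n f"
  shows "normalizable n (fscale c f)"
proof -
  from assms obtain \<alpha> where
    "f - (\<Sum>i\<in>normal_index TYPE('k) n. fscale (\<alpha> i) (normal_monomial n var i)) \<in> I"
    by (auto simp: normalizable_def)
  from fscale_in [OF this, of c]
  have "fscale c f - (\<Sum>i\<in>normal_index TYPE('k) n. fscale (c * \<alpha> i) (normal_monomial n var i)) \<in> I"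
    by (simp add: free_alg.scale_right_diff_distrib free_alg.scale_sum_right)
  then show ?thesis
    unfolding normalizable_def by (rule exI [of _ "\<lambda>i. c * \<alpha> i"])
qed

lemma normalizable_uminus: "normalizable n f \<Longrightarrow> normalizable n (- f)"
  using normalizable_fscale [of n f "- 1"] by simp

lemma normalizable_in: "f \<in> I \<Longrightarrow> normalizable n f"
  unfolding normalizable_def by (rule exI [of _ "\<lambda>_. 0"]) simp

lemma normalizable_cong:
  assumes "f - g \<in> I" "normalizable n g"
  shows "normalizable n f"
  using normalizable_add [OF normalizable_in [OF assms(1)] assms(2)] by simp

lemma normalizable_normal_monomial:
  assumes "i \<in> normal_index TYPE('k) n"
  shows "normalizable n (normal_monomial n var i)"
proof -
  have *: "(\<Sum>j\<in>normal_index TYPE('k) n. fscale (if j = i then 1 else 0) (normal_monomial n var j)) =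
      (\<Sum>j\<in>{i}. normal_monomial n var j)"
    by (rule sum.mono_neutral_cong_right) (use assms finite_normal_index in auto)
  then show ?thesis
    unfolding normalizable_def
    by (intro exI [of _ "\<lambda>j. if j = i then 1 else 0"]) (subst *, simp add: zero_in)
qed

text \<open>Sorting the letters of the commutators only costs signs modulo \<open>I\<close>. The
  sorted list then gives a normal monomial or an element of \<open>I\<close>.\<close>

lemma normalizable_mult_comm_list:
  assumes a: "a \<in> PiE {..<n} (\<lambda>_. {..<CARD('k) * CHAR('k)})"
    and s: "even (length s)" "set s \<subseteq> {..<n}"
  shows "normalizable n (prod_list (map (\<lambda>i. var i ^ a i) [0..<n]) * comm_list var s)"
proof -
  \<comment> \<open>The side conditions are premises inside \<open>P\<close> because the sorting
    principle quantifies over arbitrary lists.\<close>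
  define P where "P s \<longleftrightarrow> (even (length s) \<and> set s \<subseteq> {..<n} \<longrightarrow>
      normalizable n (prod_list (map (\<lambda>i. var i ^ a i) [0..<n]) * comm_list var s))" for s
  have "P ([] @ s)"
  proof (rule sort_adjacent_swap [of P])
    fix u i j v
    assume h: "P (u @ j # i # v)"
    show "P (u @ i # j # v)"
      unfolding P_def
    proof (intro impI, elim conjE)
      assume 1: "even (length (u @ i # j # v))" "set (u @ i # j # v) \<subseteq> {..<n}"
      let ?X = "prod_list (map (\<lambda>i. var i ^ a i) [0..<n]) :: 'k free_alg"
      have "?X * (comm_list var (u @ i # j # v) + comm_list var (u @ j # i # v)) \<in> I"
        using 1 by (intro mult_left_in comm_list_swap_in) simp
      then have "?X * comm_list var (u @ i # j # v) - - (?X * comm_list var (u @ j # i # v)) \<in> I"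
        by (simp add: distrib_left)
      moreover have "normalizable n (- (?X * comm_list var (u @ j # i # v)))"
        using h 1 by (intro normalizable_uminus) (simp add: P_def)
      ultimately show "normalizable n (?X * comm_list var (u @ i # j # v))"
        by (rule normalizable_cong)
    qed
  next
    show "P ([] @ sort s)"
      unfolding P_def
    proof (intro impI, elim conjE)
      assume 1: "even (length ([] @ sort s))" "set ([] @ sort s) \<subseteq> {..<n}"
      let ?X = "prod_list (map (\<lambda>i. var i ^ a i) [0..<n]) :: 'k free_alg"
      show "normalizable n (?X * comm_list var ([] @ sort s))"
      proof (cases "distinct s \<and> (CHAR('k) = 2 \<longrightarrow> s = [])")
        case True
        then have "(a, set s) \<in> normal_index TYPE('k) n"
          using a 1 by (auto simp: normal_index_def distinct_card)
        from normalizable_normal_monomial [OF this] show ?thesis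
          using True by (simp add: normal_monomial_def sorted_list_of_set_sort_remdups distinct_remdups_id)
      next
        case False
        then have "comm_list var (sort s) \<in> I"
          using 1 comm_list_char_2_in [of "sort s"] comm_list_not_distinct_in [of "sort s"]
          by (cases "distinct s") (simp_all, metis set_empty set_sort)
        then show ?thesis
          by (auto intro: normalizable_in mult_left_in)
      qed
    qed
  qed
  then show ?thesis
    using s by (simp add: P_def)
qed

text \<open>The power identity replaces \<open>q * p\<close> by \<open>p\<close> within an exponent,
  which lowers it as long as it is at least \<open>q * p\<close>. The resulting \<open>b\<close> is
  the same for all \<open>f\<close>.\<close>

lemma reduce_exponent: "\<exists>b < CARD('k) * CHAR('k). \<forall>f. f ^ m - f ^ b \<in> I"
proof (induction m rule: less_induct)
  case (less m)
  let ?q = "CARD('k)" and ?p = "CHAR('k)"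
  show ?case
  proof (cases "m < ?q * ?p")
    case True
    then show ?thesis using zero_in by auto
  next
    case False
    \<comment> \<open>A field has at least two elements, so the replacement strictly decreases the
      exponent.\<close>
    have "card {0, 1 :: 'k} \<le> ?q"
      by (rule card_mono) auto
    then have "?q \<ge> 2" by simp
    moreover have "?p > 0"
      using CHAR_prime [where 'a = 'k] by (rule prime_gt_0_nat)
    ultimately have "?p < ?q * ?p" by simp
    with False have "?p + (m - ?q * ?p) < m" by linarith
    from less [OF this] obtain b where
      b: "b < ?q * ?p" "\<And>f. f ^ (?p + (m - ?q * ?p)) - f ^ b \<in> I" by blast
    have "f ^ m - f ^ b \<in> I" for f
    proof -
      have "f ^ m = f ^ (?q * ?p) * f ^ (m - ?q * ?p)"
        using False by (simp flip: power_add)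
      then have *: "f ^ m - f ^ b = (f ^ (?q * ?p) - f ^ ?p) * f ^ (m - ?q * ?p)
          + (f ^ (?p + (m - ?q * ?p)) - f ^ b)"
        by (simp add: power_add left_diff_distrib)
      then show ?thesis
        unfolding * by (intro add_in mult_right_in power_in b(2))
    qed
    with b(1) show ?thesis by blast
  qed
qed

lemma prod_list_cong_in:
  assumes "\<And>i. i \<in> set l \<Longrightarrow> x i - y i \<in> I"
  shows "prod_list (map x l) - prod_list (map y l) \<in> I"
  using assms
proof (induction l)
  case Nil
  then show ?case by (simp add: zero_in)
next
  case (Cons i l)
  have "prod_list (map x (i # l)) - prod_list (map y (i # l)) =
      (x i - y i) * prod_list (map x l) + y i * (prod_list (map x l) - prod_list (map y l))"
    by (simp add: algebra_simps)
  with Cons show ?case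
    by (simp only:) (intro add_in mult_left_in mult_right_in, auto)
qed

lemma normalizable_power_mult_comm_list:
  assumes s: "even (length s)" "set s \<subseteq> {..<n}"
  shows "normalizable n (prod_list (map (\<lambda>i. var i ^ a i) [0..<n]) * comm_list var s)"
proof -
  obtain r where r: "\<And>m. r m < CARD('k) * CHAR('k)" "\<And>m f. f ^ m - f ^ r m \<in> I"
    using reduce_exponent by metis
  \<comment> \<open>The restriction makes the exponent function extensional, as membership in
    \<open>PiE\<close> demands.\<close>
  define b where "b = restrict (\<lambda>i. r (a i)) {..<n}"
  have "prod_list (map (\<lambda>i. var i ^ a i) [0..<n]) - prod_list (map (\<lambda>i. var i ^ b i) [0..<n]) \<in> I"
    by (rule prod_list_cong_in) (simp add: b_def r)
  from mult_right_in [OF this, of "comm_list var s"]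
  have "prod_list (map (\<lambda>i. var i ^ a i) [0..<n]) * comm_list var s
      - prod_list (map (\<lambda>i. var i ^ b i) [0..<n]) * comm_list var s \<in> I"
    by (simp add: left_diff_distrib)
  moreover have "normalizable n (prod_list (map (\<lambda>i. var i ^ b i) [0..<n]) * comm_list var s)"
    using s by (intro normalizable_mult_comm_list) (simp_all add: b_def r(1) PiE_iff extensional_def)
  ultimately show ?thesis
    by (rule normalizable_cong)
qed

text \<open>
  Swapping two adjacent letters of a word produces a shorter word times a commutator, because
  commutators are central modulo the ideal.
\<close>

lemma normalizable_word_mult_comm_list:
  assumes "set w \<subseteq> {..<n}" "even (length s)" "set s \<subseteq> {..<n}"
  shows "normalizable n (prod_list (map var w) * comm_list var s)"
  using assms
proof (induction w arbitrary: s rule: length_induct)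
  case (1 w s)
  \<comment> \<open>Fixing the length of \<open>w'\<close> ensures that removing two letters gives a
    word shorter than \<open>w\<close>, to which the outer induction applies.\<close>
  define P where "P w' \<longleftrightarrow> (set w' \<subseteq> {..<n} \<and> length w' = length w \<longrightarrow>
      normalizable n (prod_list (map var w') * comm_list var s))" for w'
  have "P ([] @ w)"
  proof (rule sort_adjacent_swap [of P])
    fix u i j v
    assume h: "P (u @ j # i # v)"
    show "P (u @ i # j # v)"
      unfolding P_def
    proof (intro impI, elim conjE)
      assume 2: "set (u @ i # j # v) \<subseteq> {..<n}" "length (u @ i # j # v) = length w"
      let ?w = "\<lambda>w. prod_list (map var w) :: 'k free_alg" and ?C = "comm_list var s :: 'k free_alg"
      have "?w u * (comm (comm (var i) (var j)) (?w v) * ?C) \<in> I"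
        by (intro mult_left_in mult_right_in comm_comm_in)
      then have "?w (u @ i # j # v) * ?C -
          (?w (u @ j # i # v) * ?C + ?w (u @ v) * comm_list var (i # j # s)) \<in> I"
        by (simp add: comm_def algebra_simps)
      moreover have "normalizable n (?w (u @ j # i # v) * ?C)"
        using h 2 by (auto simp: P_def)
      moreover have "normalizable n (?w (u @ v) * comm_list var (i # j # s))"
        using 1 2 by (intro "1.IH" [rule_format]) auto
      ultimately show "normalizable n (?w (u @ i # j # v) * ?C)"
        by (rule normalizable_cong [OF _ normalizable_add])
    qed
  next
    show "P ([] @ sort w)"
      using 1 by (simp add: P_def prod_list_sort normalizable_power_mult_comm_list)
  qed
  then show ?case
    using 1 by (simp add: P_def)
qed

lemma ex_normalizable: "\<exists>n. normalizable n f"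
proof -
  let ?V = "\<Union>w\<in>Poly_Mapping.keys f. set (letters w)"
  \<comment> \<open>If no letter occurs, \<open>Max ?V\<close> is unspecified, but then the bound
    below is vacuous.\<close>
  define n where "n = Suc (Max ?V)"
  have "i < n" if "i \<in> ?V" for i
    using Max_ge [of ?V i] that by (simp add: n_def less_Suc_eq_le)
  then have V: "set (letters w) \<subseteq> {..<n}" if "w \<in> Poly_Mapping.keys f" for w
    using that by blast
  have "normalizable n (\<Sum>w\<in>W. Poly_Mapping.single w (Poly_Mapping.lookup f w))"
    if "W \<subseteq> Poly_Mapping.keys f" for W
    using finite_subset [OF that finite_keys] that
  proof (induction W rule: finite_induct)
    case empty
    show ?case by (simp add: normalizable_in zero_in)
  next
    case (insert w W)
    have "normalizable n (prod_list (map var (letters w)) * comm_list var [])"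
      using insert.prems V by (intro normalizable_word_mult_comm_list) auto
    then have "normalizable n (Poly_Mapping.single w 1)"
      by (simp flip: single_Word)
    then have "normalizable n (Poly_Mapping.single w (Poly_Mapping.lookup f w))"
      by (subst single_eq_fscale) (rule normalizable_fscale)
    with insert show ?case
      by (simp add: normalizable_add)
  qed
  then show ?thesis
    by (subst free_alg_expansion) blast
qed

end

section \<open>Linear independence of the normal monomials\<close>

lemma pcompose_power: "pcompose (P ^ n) r = pcompose P r ^ n"
  for P r :: "'a::comm_semiring_1 poly"
  by (induction n) (simp_all add: pcompose_1 pcompose_mult)

text \<open>The hypothesis says that \<open>X ^ m\<close> divides the translate
  \<open>F (X + c)\<close>; translating back gives the claim.\<close>

lemma linear_power_dvdI:
  fixes F :: "'a::comm_ring_1 poly"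
  assumes "\<And>s. s < m \<Longrightarrow> coeff (pcompose F [:c, 1:]) s = 0"
  shows "[:- c, 1:] ^ m dvd F"
proof -
  have "monom 1 m dvd pcompose F [:c, 1:]"
    using assms by (simp add: monom_1_dvd_iff')
  then obtain H where "pcompose F [:c, 1:] = monom 1 m * H" ..
  moreover have "pcompose (pcompose F [:c, 1:]) [:- c, 1:] = F"
    by (simp add: pcompose_pCons flip: pcompose_assoc)
  ultimately have "F = pcompose (monom 1 m) [:- c, 1:] * pcompose H [:- c, 1:]"
    by (simp flip: pcompose_mult)
  moreover have "pcompose (monom 1 m) [:- c, 1:] = [:- c, 1:] ^ m"
    by (simp add: monom_altdef pcompose_power pcompose_pCons)
  ultimately show ?thesis by simp
qed

text \<open>Dividing by the m-th power of one linear factor lowers the degree by \<open>m\<close>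
  and leaves the orders at all other points unchanged.\<close>

lemma card_mult_le_degree:
  fixes F :: "'a::idom poly"
  assumes "finite C" "F \<noteq> 0" "\<And>c. c \<in> C \<Longrightarrow> m \<le> order c F"
  shows "card C * m \<le> degree F"
  using assms
proof (induction C arbitrary: F rule: finite_induct)
  case (insert c C)
  have "[:- c, 1:] ^ m dvd F"
    using insert.prems by (simp add: order_divides)
  then obtain H where F: "F = [:- c, 1:] ^ m * H" ..
  then have H: "H \<noteq> 0" and nz: "[:- c, 1:] ^ m * H \<noteq> 0"
    using insert.prems(1) by auto
  have "m \<le> order b H" if "b \<in> C" for b
  proof -
    have "b \<noteq> c"
      using that insert.hyps by auto
    then have "order b ([:- c, 1:] ^ m) = 0"
      by (intro order_0I) (simp add: poly_power)
    then show ?thesis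
      using insert.prems(2) [of b] that order_mult [OF nz, of b] by (simp add: F)
  qed
  with H have "card C * m \<le> degree H"
    by (rule insert.IH)
  moreover have "degree F = m + degree H"
    unfolding F using H by (subst degree_mult_eq) (simp_all add: degree_linear_power)
  ultimately show ?case
    using insert.hyps by simp
qed simp

section \<open>Supports of Grassmann elements\<close>

text \<open>Membership in the subalgebra generated by the \<open>gen i\<close> with
  \<open>i \<in> V\<close>.\<close>

definition supported :: "nat set \<Rightarrow> 'k::field grassmann \<Rightarrow> bool" where
  "supported V f \<longleftrightarrow> (\<forall>A. coord f A \<noteq> 0 \<longrightarrow> A \<subseteq> V)"

lemma supported_mono: "supported U f \<Longrightarrow> U \<subseteq> V \<Longrightarrow> supported V f"
  by (auto simp: supported_def)

lemma supported_0: "supported V 0"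
  by (simp add: supported_def)

lemma supported_1: "supported V 1"
  by (simp add: supported_def one_grassmann.rep_eq)

lemma supported_add:
  assumes "supported V f" "supported V g"
  shows "supported V (f + g)"
  unfolding supported_def
proof (intro allI impI)
  fix A assume "coord (f + g) A \<noteq> 0"
  then have "coord f A \<noteq> 0 \<or> coord g A \<noteq> 0" by auto
  then show "A \<subseteq> V" using assms by (auto simp: supported_def)
qed

lemma supported_gscale: "supported V f \<Longrightarrow> supported V (gscale c f)"
  by (simp add: supported_def)

lemma supported_sum: "(\<And>i. i \<in> I \<Longrightarrow> supported V (f i)) \<Longrightarrow> supported V (\<Sum>i\<in>I. f i)"
  by (induction I rule: infinite_finite_induct) (simp_all add: supported_0 supported_add)

lemma supported_mult:
  assumes "supported V f" "supported V g"
  shows "supported V (f * g)"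
  unfolding supported_def
proof (intro allI impI)
  fix S assume "coord (f * g) S \<noteq> 0"
  then obtain A where A: "A \<in> Pow S" "gsign A (S - A) * coord f A * coord g (S - A) \<noteq> 0"
    unfolding coord_mult by (rule sum.not_neutral_contains_not_neutral)
  then have "coord f A \<noteq> 0" "coord g (S - A) \<noteq> 0" by simp_all
  then have "A \<subseteq> V" "S - A \<subseteq> V"
    using assms by (simp_all add: supported_def)
  then show "S \<subseteq> V" by blast
qed

lemma supported_power: "supported V f \<Longrightarrow> supported V (f ^ n)"
  by (induction n) (simp_all add: supported_1 supported_mult)

lemma supported_prod_list: "(\<And>f. f \<in> set fs \<Longrightarrow> supported V f) \<Longrightarrow> supported V (prod_list fs)"
  by (induction fs) (simp_all add: supported_1 supported_mult)

lemma supported_gmon: "A \<subseteq> V \<Longrightarrow> supported V (gmon A)"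
  by (simp add: supported_def coord_gmon)

lemma gmon_eq_0_iff: "gmon A = (0 :: 'k::field grassmann) \<longleftrightarrow> infinite A"
proof
  assume "gmon A = (0 :: 'k grassmann)"
  then have "coord (gmon A) A = (0 :: 'k)" by simp
  then show "infinite A" by (auto simp: coord_gmon)
next
  assume "infinite A"
  then show "gmon A = (0 :: 'k grassmann)"
    by (intro grassmann_eqI) (simp add: coord_gmon)
qed

text \<open>For \<open>A \<subseteq> V\<close> only the splitting into \<open>A\<close> and
  \<open>T\<close> contributes to the coordinate of the product at \<open>A \<union> T\<close>,
  which is therefore \<open>coord f A\<close> up to sign.\<close>

lemma supported_mult_gmon_eq_0:
  assumes f: "supported V f" and T: "V \<inter> T = {}" "finite T" and "f * gmon T = 0"
  shows "f = 0"
proof (rule grassmann_eqI)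
  fix A
  show "coord f A = coord 0 A"
  proof (rule ccontr)
    assume nz: "coord f A \<noteq> coord 0 A"
    then have A: "A \<subseteq> V" "finite A"
      using f coord_infinite [of A f] by (auto simp: supported_def)
    have diff: "B = A \<or> A \<union> T - B \<noteq> T" if "B \<subseteq> A \<union> T" for B
      using A T that by blast
    have "0 = coord (f * gmon T) (A \<union> T)"
      using assms by simp
    also have "\<dots> = (\<Sum>B\<in>{A}. gsign B (A \<union> T - B) * coord f B * coord (gmon T) (A \<union> T - B))"
      unfolding coord_mult
      by (rule sum.mono_neutral_right) (use A T diff in \<open>auto simp: coord_gmon\<close>)
    also have "A \<union> T - A = T"
      using A T by blast
    then have "(\<Sum>B\<in>{A}. gsign B (A \<union> T - B) * coord f B * coord (gmon T) (A \<union> T - B)) =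
        gsign A T * coord f A"
      using T by (simp add: coord_gmon)
    finally show False
      using nz by (simp add: gsign_def)
  qed
qed

section \<open>Nilpotent even elements and independence of their powers\<close>

text \<open>Uses the block of \<open>2 * m\<close> generators starting at \<open>b\<close>; the
  summands are even, hence central, and square to zero.\<close>

definition pair_sum :: "nat \<Rightarrow> nat \<Rightarrow> 'k::field grassmann" where
  "pair_sum b m = (\<Sum>j<m. gmon {b + 2 * j, b + 2 * j + 1})"

lemma central_pair_sum: "central (pair_sum b m)"
  unfolding pair_sum_def by (intro central_sum even_elem_central even_elem_gmon) simp

lemma supported_pair_sum: "supported {b..<b + 2 * m} (pair_sum b m)"
  unfolding pair_sum_def by (intro supported_sum supported_gmon) auto

text \<open>Both claims are proved together: adding one more pair expands the power by
  \<open>power_add_square_zero\<close>, and the vanishing of the next power at stage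
  \<open>m\<close> leaves only the term with the factor \<open>Suc m\<close>.\<close>

lemma
  shows pair_sum_power_top: "pair_sum b m ^ m = gscale (of_nat (fact m)) (gmon {b..<b + 2 * m} :: 'k::field grassmann)"
    and pair_sum_power_Suc: "pair_sum b m ^ Suc m = (0 :: 'k::field grassmann)"
proof -
  have "pair_sum b m ^ m = gscale (of_nat (fact m)) (gmon {b..<b + 2 * m} :: 'k grassmann) \<and>
    pair_sum b m ^ Suc m = (0 :: 'k grassmann)"
  proof (induction m)
    case 0
    then show ?case by (simp add: pair_sum_def gmon_empty)
  next
    case (Suc m)
    let ?g = "pair_sum b m :: 'k grassmann" and ?T = "{b..<b + 2 * m}"
    let ?Z = "{b + 2 * m, b + 2 * m + 1}"
    let ?z = "gmon ?Z :: 'k grassmann"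
    have step: "pair_sum b (Suc m) = ?g + ?z"
      by (simp add: pair_sum_def)
    have power: "(?g + ?z) ^ Suc k = ?g ^ Suc k + of_nat (Suc k) * ?g ^ k * ?z" for k
      by (intro power_add_square_zero centralD central_pair_sum gmon_square) simp
    \<comment> \<open>The new pair lies after the old block, so multiplying the monomials introduces
      no sign.\<close>
    have "{(i, j). i \<in> ?T \<and> j \<in> ?Z \<and> j < i} = {}"
      by auto
    then have sign: "gsign ?T ?Z = (1 :: 'k)"
      by (simp only: gsign_def card.empty power_0)
    have union: "?T \<union> ?Z = {b..<b + 2 * Suc m}" and disj: "?T \<inter> ?Z = {}"
      by auto
    have "pair_sum b (Suc m) ^ Suc m = of_nat (Suc m) * ?g ^ m * ?z"
      by (simp only: step power Suc.IH add_0)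
    also have "\<dots> = of_nat (Suc m) * gscale (of_nat (fact m)) (gmon ?T * ?z)"
      by (simp only: Suc.IH mult.assoc gscale_mult_left)
    also have "gmon ?T * ?z = gmon {b..<b + 2 * Suc m}"
      using gmon_mult [of ?T ?Z, where 'k = 'k] by (simp only: finite_atLeastLessThan finite.intros
          simp_thms disj if_True sign union gscale_1)
    also have "of_nat (Suc m) * gscale (of_nat (fact m)) (gmon {b..<b + 2 * Suc m}) =
        gscale (of_nat (fact (Suc m))) (gmon {b..<b + 2 * Suc m} :: 'k grassmann)"
      by (simp only: of_nat_grassmann gscale_mult_left mult_1_left gscale_gscale fact_Suc of_nat_mult of_nat_id)
    finally have 1: "pair_sum b (Suc m) ^ Suc m =
        gscale (of_nat (fact (Suc m))) (gmon {b..<b + 2 * Suc m} :: 'k grassmann)" .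
    have "?g ^ Suc (Suc m) = 0"
      by (simp only: power_Suc [of _ "Suc m"] Suc.IH mult_zero_right)
    then have "pair_sum b (Suc m) ^ Suc (Suc m) = (0 :: 'k grassmann)"
      by (simp only: step power Suc.IH mult_zero_left mult_zero_right add_0)
    with 1 show ?case by blast
  qed
  then show "pair_sum b m ^ m = gscale (of_nat (fact m)) (gmon {b..<b + 2 * m} :: 'k grassmann)"
    and "pair_sum b m ^ Suc m = (0 :: 'k grassmann)"
    by blast+
qed

text \<open>The binomial theorem, with the binomial coefficients kept as coefficients of
  \<open>(X + c) ^ a\<close> so that they can be matched with a translated polynomial later.\<close>

lemma scalar_add_power:
  fixes g :: "'k::field grassmann"
  shows "(gscale c 1 + g) ^ a = (\<Sum>s\<le>a. gscale (coeff ([:c, 1:] ^ a) s) (g ^ s))"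
proof (induction a)
  case 0
  then show ?case by simp
next
  case (Suc a)
  let ?k = "coeff ([:c, 1:] ^ a)"
  have top: "?k (Suc a) = 0"
    by (intro coeff_eq_0) (simp add: degree_linear_power)
  have "(gscale c 1 + g) ^ Suc a = gscale c ((gscale c 1 + g) ^ a) + g * (gscale c 1 + g) ^ a"
    by (simp add: distrib_right gscale_mult_left)
  also have "\<dots> = (\<Sum>s\<le>a. gscale (c * ?k s) (g ^ s)) + (\<Sum>s\<le>a. gscale (?k s) (g ^ Suc s))"
    by (simp add: Suc.IH gscale_sum_right sum_distrib_left gscale_mult_right)
  also have "(\<Sum>s\<le>a. gscale (c * ?k s) (g ^ s)) = (\<Sum>s\<le>Suc a. gscale (c * ?k s) (g ^ s))"
    by (simp add: top)
  also have "(\<Sum>s\<le>a. gscale (?k s) (g ^ Suc s)) =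
      (\<Sum>s\<le>Suc a. gscale (coeff (pCons 0 ([:c, 1:] ^ a)) s) (g ^ s))"
    by (subst sum.atMost_Suc_shift) simp
  also have "(\<Sum>s\<le>Suc a. gscale (c * ?k s) (g ^ s)) + \<dots> =
      (\<Sum>s\<le>Suc a. gscale (coeff ([:c, 1:] ^ Suc a) s) (g ^ s))"
    unfolding sum.distrib [symmetric] by (rule sum.cong) (simp_all add: gscale_add_left)
  finally show ?case .
qed

text \<open>Multiplication by \<open>g ^ (p - 1 - s)\<close> kills the terms above \<open>s\<close>
  by nilpotency, and those below vanish by induction. What is left is a nonzero scalar times
  \<open>K s * gmon T\<close>.\<close>

lemma powers_independent:
  fixes K :: "nat \<Rightarrow> 'k::field grassmann"
  assumes supp: "\<And>s. s < p \<Longrightarrow> supported V (K s)" and T: "V \<inter> T = {}" "finite T"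
    and g: "g ^ p = 0" "g ^ (p - 1) = gscale d (gmon T)" "d \<noteq> 0"
    and zero: "(\<Sum>s<N. K s * g ^ s) = 0" and N: "p \<le> N"
  shows "s < p \<Longrightarrow> K s = 0"
proof (induction s rule: less_induct)
  case (less s)
  have "K t * g ^ (t + (p - 1 - s)) = 0" if "t \<noteq> s" for t
  proof (cases "t < s")
    case True
    then show ?thesis using less by simp
  next
    case False
    then have "t + (p - 1 - s) = p + (t - s - 1)"
      using that less.prems by simp
    then show ?thesis by (simp add: power_add g(1))
  qed
  then have "(\<Sum>t<N. K t * g ^ (t + (p - 1 - s))) = (\<Sum>t\<in>{s}. K t * g ^ (t + (p - 1 - s)))"
    by (intro sum.mono_neutral_right) (use less.prems N in auto)
  also have "(\<Sum>t<N. K t * g ^ (t + (p - 1 - s))) = (\<Sum>t<N. K t * g ^ t) * g ^ (p - 1 - s)"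
    by (simp add: sum_distrib_right power_add mult.assoc)
  finally have "K s * g ^ (p - 1) = 0"
    using less.prems by (simp add: zero)
  then have "K s * gmon T = 0"
    using g by (simp add: gscale_mult_right gscale_eq_0_iff)
  with supp [OF less.prems] T show ?case
    by (rule supported_mult_gmon_eq_0)
qed

lemma shifted_powers_independent:
  fixes h :: "nat \<Rightarrow> 'k::finite_field grassmann"
  defines "p \<equiv> CHAR('k)" and "N \<equiv> CARD('k) * CHAR('k)"
  assumes supp: "\<And>a. a < N \<Longrightarrow> supported V (h a)" and T: "V \<inter> T = {}" "finite T"
    and g: "g ^ p = 0" "g ^ (p - 1) = gscale d (gmon T)" "d \<noteq> 0"
    and zero: "\<And>c. (\<Sum>a<N. h a * (gscale c 1 + g) ^ a) = 0"
    and a: "a < N"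
  shows "h a = 0"
proof -
  have pN: "p \<le> N"
    by (simp add: p_def N_def Suc_le_eq)
  \<comment> \<open>\<open>K c s\<close> is the coefficient of \<open>g ^ s\<close> after expanding
    the powers of \<open>gscale c 1 + g\<close>. Its coordinates are the coefficients of the
    polynomial \<open>F\<close> below, translated by \<open>c\<close>.\<close>
  define K where "K c s = (\<Sum>a<N. gscale (coeff ([:c, 1:] ^ a) s) (h a))" for c s
  have K0: "K c s = 0" if "s < p" for c s
  proof (rule powers_independent [where K = "K c" and V = V and N = N, OF _ T g _ pN that])
    show "supported V (K c s)" for s
      unfolding K_def by (intro supported_sum supported_gscale supp) simp
    have "(\<Sum>s<N. K c s * g ^ s) =
        (\<Sum>s<N. \<Sum>a<N. h a * gscale (coeff ([:c, 1:] ^ a) s) (g ^ s))"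
      by (simp add: K_def sum_distrib_right gscale_mult_left gscale_mult_right)
    also have "\<dots> = (\<Sum>a<N. h a * (\<Sum>s<N. gscale (coeff ([:c, 1:] ^ a) s) (g ^ s)))"
      by (subst sum.swap) (simp add: sum_distrib_left)
    also have "\<dots> = (\<Sum>a<N. h a * (gscale c 1 + g) ^ a)"
    proof (intro sum.cong refl)
      fix a assume "a \<in> {..<N}"
      then have "(\<Sum>s<N. gscale (coeff ([:c, 1:] ^ a) s) (g ^ s)) =
          (\<Sum>s\<le>a. gscale (coeff ([:c, 1:] ^ a) s) (g ^ s))"
        by (intro sum.mono_neutral_right) (auto simp: coeff_eq_0 degree_linear_power)
      then show "h a * (\<Sum>s<N. gscale (coeff ([:c, 1:] ^ a) s) (g ^ s)) = h a * (gscale c 1 + g) ^ a"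
        by (simp add: scalar_add_power)
    qed
    finally show "(\<Sum>s<N. K c s * g ^ s) = 0"
      by (simp add: zero)
  qed
  show ?thesis
  proof (rule grassmann_eqI)
    fix A
    define F where "F = (\<Sum>a<N. smult (coord (h a) A) (monom 1 a))"
    have coeff_F: "coeff F b = (if b < N then coord (h b) A else 0)" for b
      by (simp add: F_def coeff_sum if_distrib [of "\<lambda>x. _ * x"] cong: if_cong)
    have "coeff (pcompose F [:c, 1:]) s = coord (K c s) A" for c s
      by (simp add: F_def K_def pcompose_sum pcompose_smult monom_altdef pcompose_power
          pcompose_pCons coeff_sum coord_sum mult.commute)
    then have "[:- c, 1:] ^ p dvd F" for c
      by (intro linear_power_dvdI) (simp add: K0)
    then have order: "p \<le> order c F" if "F \<noteq> 0" for c
      using that by (simp add: order_divides)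
    have "F = 0"
    proof (rule ccontr)
      assume "F \<noteq> 0"
      then have "CARD('k) * p \<le> degree F"
        using order by (intro card_mult_le_degree) simp_all
      moreover have "degree F < N"
        using a by (intro degree_lessI) (simp_all add: coeff_F)
      ultimately show False
        by (simp add: N_def p_def)
    qed
    then show "coord (h a) A = coord 0 A"
      using coeff_F [of a] a by simp
  qed
qed

section \<open>Independence of monomials in even points\<close>

text \<open>The blocks of generators for different \<open>i\<close> are disjoint, and all of them
  avoid the first \<open>n\<close> generators, which are reserved for the commutators.\<close>

definition even_point :: "nat \<Rightarrow> (nat \<Rightarrow> 'k) \<Rightarrow> nat \<Rightarrow> 'k::finite_field grassmann" where
  "even_point n c i = gscale (c i) 1 + pair_sum (n + 2 * (CHAR('k) - 1) * i) (CHAR('k) - 1)"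

lemma central_even_point: "central (even_point n c i)"
  unfolding even_point_def by (intro central_add central_gscale central_1 central_pair_sum)

text \<open>The variables are removed from the last one down. The nilpotent part of the last point
  uses generators absent from everything else, so \<open>shifted_powers_independent\<close>
  separates its exponents, and the induction hypothesis handles each resulting sum.\<close>

lemma even_monomials_independent:
  fixes W :: "'k::finite_field grassmann"
  defines "N \<equiv> CARD('k) * CHAR('k)"
  assumes W: "supported {..<n} W" "W \<noteq> 0"
    and zero: "\<And>c. (\<Sum>a\<in>PiE {..<m} (\<lambda>_. {..<N}).
      gscale (\<alpha> a) (W * prod_list (map (\<lambda>i. even_point n c i ^ a i) [0..<m]))) = 0"
    and a: "a \<in> PiE {..<m} (\<lambda>_. {..<N})"
  shows "\<alpha> a = 0"
  using zero a
proof (induction m arbitrary: \<alpha> a)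
  case 0
  then show ?case
    using W by (simp add: gscale_eq_0_iff)
next
  case (Suc m)
  let ?p = "CHAR('k)"
  let ?P = "PiE {..<m} (\<lambda>_. {..<N})"
  let ?X = "\<lambda>c a. prod_list (map (\<lambda>i. even_point n c i ^ a i) [0..<m]) :: 'k grassmann"
  let ?V = "{..<n + 2 * (?p - 1) * m}" and ?T = "{n + 2 * (?p - 1) * m..<n + 2 * (?p - 1) * m + 2 * (?p - 1)}"
  have p: "prime ?p" by (rule CHAR_prime)
  then have Suc_p: "Suc (?p - 1) = ?p"
    using prime_gt_0_nat by simp
  have PiE_Suc: "(\<Sum>a\<in>PiE {..<Suc m} (\<lambda>_. {..<N}). f a) = (\<Sum>b<N. \<Sum>a\<in>?P. f (a(m := b)))"
    for f :: "(nat \<Rightarrow> nat) \<Rightarrow> 'k grassmann"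
    unfolding lessThan_Suc PiE_insert_eq
    by (subst sum.reindex [OF inj_combinator]) (simp_all add: sum.cartesian_product case_prod_unfold)
  have inner: "(\<Sum>a\<in>?P. gscale (\<alpha> (a(m := b))) (W * ?X c a)) = 0" if b: "b < N" for b c
  proof -
    define h where "h b = (\<Sum>a\<in>?P. gscale (\<alpha> (a(m := b))) (W * ?X c a))" for b
    let ?g = "pair_sum (n + 2 * (?p - 1) * m) (?p - 1) :: 'k grassmann"
    have "h b = 0"
    proof (rule shifted_powers_independent [where V = ?V and T = ?T and g = ?g and h = h and d = "of_nat (fact (?p - 1))"])
      show "?g ^ ?p = 0"
        using pair_sum_power_Suc [of "n + 2 * (?p - 1) * m" "?p - 1"] unfolding Suc_p .
      show "?g ^ (?p - 1) = gscale (of_nat (fact (?p - 1))) (gmon ?T)"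
        by (rule pair_sum_power_top)
      \<comment> \<open>The top power has coefficient \<open>(p - 1)!\<close>, which is nonzero in
        characteristic \<open>p\<close>.\<close>
      have "\<not> ?p dvd fact (?p - 1)"
        using Suc_p by (simp only: prime_dvd_fact_iff [OF p])
      then show "of_nat (fact (?p - 1)) \<noteq> (0 :: 'k)"
        by (simp only: of_nat_eq_0_iff_char_dvd not_False_eq_True)
      show "?V \<inter> ?T = {}" "finite ?T" by auto
      show "b < CARD('k) * ?p"
        using b by (simp add: N_def)
      have point: "supported ?V (even_point n c i)" if "i < m" for i
      proof -
        have "2 * (?p - 1) * Suc i \<le> 2 * (?p - 1) * m"
          using that by (intro mult_le_mono2) simp
        then have "{n + 2 * (?p - 1) * i..<n + 2 * (?p - 1) * i + 2 * (?p - 1)} \<subseteq> ?V"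
          by auto
        then show ?thesis
          unfolding even_point_def
          by (intro supported_add supported_gscale supported_1 supported_mono [OF supported_pair_sum])
      qed
      have "supported ?V W"
        using W(1) by (rule supported_mono) auto
      then show "supported ?V (h b)" for b
        unfolding h_def
      proof (intro supported_sum supported_gscale supported_mult supported_prod_list)
        fix a f assume "f \<in> set (map (\<lambda>i. even_point n c i ^ a i) [0..<m])"
        then obtain i where "i < m" "f = even_point n c i ^ a i" by auto
        then show "supported ?V f"
          using point [of i] supported_power by blast
      qed
      show "(\<Sum>b<CARD('k) * ?p. h b * (gscale t 1 + ?g) ^ b) = 0" for t
      proof -
        \<comment> \<open>Only the scalar of the last point varies; the earlier points, and with
          them the coefficients \<open>h b\<close>, stay fixed.\<close>
        let ?c = "c(m := t)"
        have 1: "even_point n ?c m = gscale t 1 + ?g"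
          by (simp add: even_point_def)
        have 2: "map (\<lambda>i. even_point n ?c i ^ (a(m := b)) i) [0..<m] = map (\<lambda>i. even_point n c i ^ a i) [0..<m]"
          for a b
          by (simp add: even_point_def)
        have "(\<Sum>b<N. \<Sum>a\<in>?P. gscale (\<alpha> (a(m := b)))
            (W * prod_list (map (\<lambda>i. even_point n ?c i ^ (a(m := b)) i) [0..<Suc m]))) = 0"
          using Suc.prems(1) [of ?c] unfolding PiE_Suc .
        then have "(\<Sum>b<N. \<Sum>a\<in>?P. gscale (\<alpha> (a(m := b))) (W * ?X c a) * (gscale t 1 + ?g) ^ b) = 0"
          unfolding upt_Suc_append [OF le0] map_append 2 by (simp add: 1 mult.assoc gscale_mult_left)
        then show ?thesis
          by (simp add: h_def sum_distrib_right N_def)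
      qed
    qed
    then show ?thesis by (simp add: h_def)
  qed
  from Suc.prems(2) obtain b a' where ab: "a = a'(m := b)" "b < N" "a' \<in> ?P"
    unfolding lessThan_Suc PiE_insert_eq by auto
  have "\<alpha> (a'(m := b)) = 0"
    by (rule Suc.IH [where \<alpha> = "\<lambda>a. \<alpha> (a(m := b))"]) (use inner ab in auto)
  then show ?case by (simp only: ab)
qed

section \<open>Evaluation of normal monomials\<close>

lemma hom_comm_list:
  assumes "unital_alg_hom s1 s2 \<phi>"
  shows "\<phi> (comm_list x s) = comm_list (\<lambda>i. \<phi> (x i)) s"
  by (induction x s rule: comm_list.induct)
     (simp_all add: hom_mult [OF assms] hom_comm [OF assms] hom_one [OF assms])

lemma hom_normal_monomial:
  assumes "unital_alg_hom s1 s2 \<phi>"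
  shows "\<phi> (normal_monomial n x i) = normal_monomial n (\<lambda>i. \<phi> (x i)) i"
  by (simp add: normal_monomial_def case_prod_unfold hom_mult [OF assms] hom_prod_list [OF assms]
      hom_power [OF assms] hom_comm_list [OF assms] o_def)

text \<open>Even length guarantees that \<open>i\<close> is paired, and its commutator
  vanishes.\<close>

lemma comm_list_eq_0:
  assumes "even (length s)" "i \<in> set s" "central (x i)"
  shows "comm_list x s = 0"
  using assms
proof (induction x s rule: comm_list.induct)
  case (1 x j k s)
  then show ?case
    using centralD [OF 1(4), of "x j"] centralD [OF 1(4), of "x k"] by (auto simp: comm_def)
qed auto

lemma comm_list_gen:
  "even (length s) \<Longrightarrow>
    comm_list gen s = gscale (2 ^ (length s div 2)) (prod_list (map gen s) :: 'k::field grassmann)"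
proof (induction "gen :: nat \<Rightarrow> 'k grassmann" s rule: comm_list.induct)
  case (1 i j s)
  have "gen j * gen i = - (gen i * gen j :: 'k grassmann)"
    by (rule gen_anticommute)
  then have "comm (gen i) (gen j) = gen i * gen j + (gen i * gen j :: 'k grassmann)"
    by (simp add: comm_def)
  also have "\<dots> = gscale 2 (gen i * gen j)"
    using gscale_add_left [of 1 1 "gen i * gen j :: 'k grassmann"] by simp
  finally show ?case
    using 1 by (simp add: gscale_mult_left gscale_mult_right mult.assoc)
qed simp_all

lemma comm_list_add_central:
  assumes "\<And>i. i \<in> set s \<Longrightarrow> central (y i) \<and> x i = y i + z i"
  shows "comm_list x s = comm_list z s"
  using assms by (induction x s rule: comm_list.induct) (simp_all add: comm_add_central)

text \<open>Lets the odd summands \<open>gen i\<close> disappear from the powers: they annihilate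
  the product \<open>W\<close> of commutators, while the central parts move past it.\<close>

lemma prod_list_power_mult_cong:
  assumes "\<And>i. i \<in> set l \<Longrightarrow> central (y i)" and "\<And>i. i \<in> set l \<Longrightarrow> x i * W = y i * W"
  shows "prod_list (map (\<lambda>i. x i ^ a i) l) * W = W * prod_list (map (\<lambda>i. (y i :: 'a::ring_1) ^ a i) l)"
  using assms
proof (induction l)
  case (Cons i l)
  let ?Y = "prod_list (map (\<lambda>i. y i ^ a i) l)"
  have power: "x i ^ m * W = W * y i ^ m" for m
  proof (induction m)
    case (Suc m)
    have "x i ^ Suc m * W = x i * W * y i ^ m"
      by (simp add: Suc mult.assoc)
    also have "\<dots> = W * y i ^ Suc m"
      using Cons.prems centralD [of "y i" W] by (simp add: mult.assoc)
    finally show ?case .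
  qed simp
  have "prod_list (map (\<lambda>i. x i ^ a i) (i # l)) * W = x i ^ a i * (W * ?Y)"
    using Cons by (simp add: mult.assoc)
  also have "\<dots> = (x i ^ a i * W) * ?Y"
    by (simp add: mult.assoc)
  finally show ?case
    by (simp add: power mult.assoc)
qed simp

text \<open>Induction on the size of \<open>S\<close>: proper subsets \<open>R\<close> of
  \<open>S\<close> already have zero coefficients, and any \<open>R\<close> not contained in
  \<open>S\<close> gives a commutator with a central entry. Only the terms with commutator part
  \<open>S\<close> remain, and \<open>even_monomials_independent\<close> applies to them.\<close>

lemma normal_monomials_independent:
  fixes \<alpha> :: "(nat \<Rightarrow> nat) \<times> nat set \<Rightarrow> 'k::finite_field"
  assumes F: "(\<Sum>i\<in>normal_index TYPE('k) n. fscale (\<alpha> i) (normal_monomial n var i)) \<in> T_G"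
  shows "(a, S) \<in> normal_index TYPE('k) n \<Longrightarrow> \<alpha> (a, S) = 0"
proof (induction "card S" arbitrary: a S rule: less_induct)
  case (less S a)
  let ?N = "normal_index TYPE('k) n" and ?P = "PiE {..<n} (\<lambda>_. {..<CARD('k) * CHAR('k)})"
  let ?s = "sorted_list_of_set"
  have S: "S \<subseteq> {..<n}" "even (card S)" "CHAR('k) = 2 \<Longrightarrow> S = {}" and a: "a \<in> ?P"
    using less.prems by (auto simp: normal_index_def)
  then have finS: "finite S"
    using finite_subset by blast
  define W :: "'k grassmann" where "W = comm_list gen (?s S)"
  have W_eq: "W = gscale (2 ^ (card S div 2)) (gmon S)"
    using S finS by (simp add: W_def comm_list_gen prod_list_gen)
  \<comment> \<open>In characteristic 2 the set \<open>S\<close> is empty, so the exponent is 0 and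
    the power is 1.\<close>
  have "(2 :: 'k) ^ (card S div 2) \<noteq> 0"
    using S(3) by (cases "CHAR('k) = 2") (simp_all add: two_neq_zero_of_CHAR)
  then have W0: "W \<noteq> 0"
    using finS by (simp add: W_eq gscale_eq_0_iff gmon_eq_0_iff)
  have W_supp: "supported {..<n} W"
    unfolding W_eq using S by (intro supported_gscale supported_gmon)
  have eW: "gen i * W = 0" if "i \<in> S" for i
    using that finS gmon_mult [of "{i}" S, where 'k = 'k] by (simp add: W_eq gscale_mult_right gen_def)
  show ?case
  proof (rule even_monomials_independent [OF W_supp W0 _ a, where \<alpha> = "\<lambda>a. \<alpha> (a, S)"])
    fix c :: "nat \<Rightarrow> 'k"
    let ?y = "even_point n c :: nat \<Rightarrow> 'k grassmann"
    define \<sigma> where "\<sigma> i = ?y i + (if i \<in> S then gen i else 0)" for i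
    define \<phi> where "\<phi> = feval gscale \<sigma>"
    have hom: "unital_alg_hom fscale gscale \<phi>"
      unfolding \<phi>_def by (rule grassmann.unital_alg_hom_feval)
    have "(\<Sum>i\<in>?N. gscale (\<alpha> i) (normal_monomial n \<sigma> i)) =
        \<phi> (\<Sum>i\<in>?N. fscale (\<alpha> i) (normal_monomial n var i))"
      by (simp add: hom_sum [OF hom] hom_scale [OF hom] hom_normal_monomial [OF hom])
         (simp add: \<phi>_def grassmann.feval_var)
    also have "\<dots> = 0"
      using F hom by (simp add: T_G_def)
    finally have "0 = (\<Sum>i\<in>?N. gscale (\<alpha> i) (normal_monomial n \<sigma> i))" by simp
    also have "\<dots> = (\<Sum>i\<in>?P \<times> {S}. gscale (\<alpha> i) (normal_monomial n \<sigma> i))"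
    proof (rule sum.mono_neutral_right)
      show "finite ?N" by (rule finite_normal_index)
      show "?P \<times> {S} \<subseteq> ?N"
        using S by (auto simp: normal_index_def)
      show "\<forall>i\<in>?N - ?P \<times> {S}. gscale (\<alpha> i) (normal_monomial n \<sigma> i) = 0"
      proof
        fix i assume i: "i \<in> ?N - ?P \<times> {S}"
        obtain b R where bR: "i = (b, R)" by (cases i)
        have R: "R \<subseteq> {..<n}" "even (card R)" "R \<noteq> S"
          using i by (auto simp: bR normal_index_def)
        show "gscale (\<alpha> i) (normal_monomial n \<sigma> i) = 0"
        proof (cases "R \<subseteq> S")
          case True
          then have "card R < card S"
            using R(3) finS by (intro psubset_card_mono) auto
          then have "\<alpha> i = 0"
            unfolding bR using i by (intro less.hyps) (simp_all add: bR)
          then show ?thesis by simp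
        next
          case False
          then obtain j where "j \<in> R" "j \<notin> S" by blast
          moreover have "finite R"
            using R(1) by (rule finite_subset) simp
          ultimately have "comm_list \<sigma> (?s R) = 0"
            using R(2) by (intro comm_list_eq_0 [of _ j]) (simp_all add: \<sigma>_def central_even_point)
          then show ?thesis
            by (simp add: bR normal_monomial_def)
        qed
      qed
    qed
    also have "\<dots> = (\<Sum>a\<in>?P. gscale (\<alpha> (a, S)) (normal_monomial n \<sigma> (a, S)))"
    proof -
      have "?P \<times> {S} = (\<lambda>a. (a, S)) ` ?P" by blast
      moreover have "inj_on (\<lambda>a. (a, S)) ?P" by (rule inj_onI) simp
      ultimately show ?thesis by (simp only: sum.reindex o_def)
    qed
    also have "\<dots> = (\<Sum>a\<in>?P. gscale (\<alpha> (a, S)) (W * prod_list (map (\<lambda>i. ?y i ^ a i) [0..<n])))"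
    proof (intro sum.cong refl)
      fix a
      have "comm_list \<sigma> (?s S) = W"
        unfolding W_def
        by (rule comm_list_add_central [where y = ?y]) (use finS in \<open>simp add: \<sigma>_def central_even_point\<close>)
      moreover have "\<sigma> i * W = ?y i * W" for i
        by (simp add: \<sigma>_def distrib_right eW)
      ultimately show "gscale (\<alpha> (a, S)) (normal_monomial n \<sigma> (a, S)) =
          gscale (\<alpha> (a, S)) (W * prod_list (map (\<lambda>i. ?y i ^ a i) [0..<n]))"
        by (simp add: normal_monomial_def prod_list_power_mult_cong central_even_point)
    qed
    finally show "(\<Sum>a\<in>?P. gscale (\<alpha> (a, S)) (W * prod_list (map (\<lambda>i. ?y i ^ a i) [0..<n]))) = 0"
      by simp
  qed
qed

section \<open>Equality of the T-ideals\<close>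

text \<open>The normal form of \<open>f\<close> differs from it by an element of \<open>I\<close>,
  hence is itself an identity of the Grassmann algebra. Independence makes all its coefficients
  zero.\<close>

lemma (in grassmann_identities) T_G_subset:
  assumes "I \<subseteq> T_G"
  shows "T_G \<subseteq> I"
proof
  fix f :: "'k free_alg" assume f: "f \<in> T_G"
  obtain n \<alpha> where n: "f - (\<Sum>i\<in>normal_index TYPE('k) n. fscale (\<alpha> i) (normal_monomial n var i)) \<in> I"
    (is "f - ?F \<in> I")
    using ex_normalizable [of f] unfolding normalizable_def by blast
  have "f + (- 1) * (f - ?F) \<in> T_G"
    using T_ideal_T_G f assms n unfolding T_ideal_def by blast
  then have "?F \<in> T_G" by simp
  then have "\<alpha> i = 0" if "i \<in> normal_index TYPE('k) n" for i
    using normal_monomials_independent [where n = n and \<alpha> = \<alpha> and a = "fst i" and S = "snd i"] that by simp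
  then have "?F = 0" by simp
  with n show "f \<in> I" by simp
qed

text \<open>The p-th power of an element is a scalar, and scalars are fixed by the q-th
  power.\<close>

lemma power_var_in_T_G:
  "var 0 ^ (CARD('k) * CHAR('k)) - var 0 ^ CHAR('k) \<in> (T_G :: 'k::finite_field free_alg set)"
  unfolding T_G_def
proof (intro CollectI allI impI)
  fix \<phi> :: "'k free_alg \<Rightarrow> 'k grassmann"
  assume hom: "unital_alg_hom fscale gscale \<phi>"
  have "x ^ (CARD('k) * CHAR('k)) = x ^ CHAR('k)" for x :: "'k grassmann"
    by (subst mult.commute)
       (simp add: power_mult grassmann_power_CHAR gscale_1_power finite_field_power_card_eq_same)
  then show "\<phi> (var 0 ^ (CARD('k) * CHAR('k)) - var 0 ^ CHAR('k)) = 0"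
    by (simp add: hom_diff [OF hom] hom_power [OF hom])
qed

lemma comm_comm_in_T_G: "comm (comm f g) h \<in> T_G"
  by (auto simp: T_G_def hom_comm comm_comm_grassmann)

lemma comm_in_T_G:
  assumes "CHAR('k::finite_field) = 2"
  shows "comm f g \<in> (T_G :: 'k free_alg set)"
proof -
  have "comm x y = 0" for x y :: "'k grassmann"
    using centralD [OF central_char_2 [OF assms], of x y] by (simp add: comm_def)
  then show ?thesis
    by (auto simp: T_G_def hom_comm)
qed

lemma subset_T_closure: "B \<subseteq> T_closure B"
  by (auto simp: T_closure_def)

lemma T_closure_subset: "T_ideal J \<Longrightarrow> B \<subseteq> J \<Longrightarrow> T_closure B \<subseteq> J"
  by (auto simp: T_closure_def)

lemma T_G_eq_T_closure:
  fixes B :: "'k::finite_field free_alg set"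
  assumes "B \<subseteq> T_G" "grassmann_identities (T_closure B)"
  shows "T_G = T_closure B"
  using T_closure_subset [OF T_ideal_T_G assms(1)] grassmann_identities.T_G_subset [OF assms(2)]
  by blast

theorem theorem3p1:
  fixes p q :: nat
  assumes "CHAR('k::finite_field) = p" and "CARD('k) = q"
  shows "if p = 2
    then (T_G :: 'k free_alg set) =
      T_closure {var 0 ^ 2 - var 0 ^ (2 * q), comm (var 0) (var 1)}
    else (T_G :: 'k free_alg set) =
      T_closure {var 0 ^ (q * p) - var 0 ^ p, comm (comm (var 0) (var 1)) (var 2)}"
proof (cases "p = 2")
  case True
  let ?B = "{var 0 ^ 2 - var 0 ^ (2 * q), comm (var 0) (var 1)} :: 'k free_alg set"
  have neg: "- f \<in> J" if "T_ideal J" "f \<in> J" for f and J :: "'k free_alg set"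
  proof -
    have "(- 1) * f \<in> J"
      using that unfolding T_ideal_def by blast
    then show ?thesis by simp
  qed
  have "T_G = T_closure ?B"
  proof (rule T_G_eq_T_closure)
    have "- (var 0 ^ (q * 2) - var 0 ^ 2 :: 'k free_alg) \<in> T_G"
      using power_var_in_T_G [where 'k = 'k] True assms by (intro neg T_ideal_T_G) simp
    moreover have "comm (var 0) (var 1) \<in> (T_G :: 'k free_alg set)"
      using True assms by (intro comm_in_T_G) simp
    ultimately show "?B \<subseteq> T_G"
      by (simp add: mult.commute)
    let ?J = "T_closure ?B"
    have J: "T_ideal ?J" by (rule T_ideal_T_closure)
    have c: "comm (var 0) (var 1) \<in> ?J"
      using subset_T_closure [of ?B] by blast
    have "- (var 0 ^ 2 - var 0 ^ (2 * q)) \<in> ?J"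
      using subset_T_closure [of ?B] by (intro neg J) blast
    \<comment> \<open>This is the triple commutator, obtained here from the commutator by
      absorption.\<close>
    moreover have "comm (var 0) (var 1) * var 2 + (- var 2) * comm (var 0) (var 1) \<in> ?J"
      using J c unfolding T_ideal_def by blast
    ultimately show "grassmann_identities ?J"
      using J c True assms
      by unfold_locales (simp_all add: mult.commute comm_def [of "comm _ _"])
  qed
  with True show ?thesis by simp
next
  case False
  let ?B = "{var 0 ^ (q * p) - var 0 ^ p, comm (comm (var 0) (var 1)) (var 2)} :: 'k free_alg set"
  have "T_G = T_closure ?B"
  proof (rule T_G_eq_T_closure)
    show "?B \<subseteq> T_G"
      using power_var_in_T_G [where 'k = 'k] assms by (simp add: comm_comm_in_T_G)
    show "grassmann_identities (T_closure ?B)"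
      using subset_T_closure [of ?B] T_ideal_T_closure [of ?B] False assms
      by unfold_locales auto
  qed
  with False show ?thesis by simp
qed

end
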